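(* Let $F:\mathbb{R}^d\to\mathbb{R}$ and $\varphi:\mathbb{R}^d\to\mathbb{R}$ be differentiable, let $\gamma>0$, let $\nabla f(x,\xi)$ be a stochastic gradient of $F$, and let $\{p_k\}_{k\ge 0}$, $\{q_k\}_{k\ge 0}$ be generated by the scheme given in the context. Assume the following. (a) $\lim_{\|x\|_2\to\infty}F(x)=\infty$; there is $F_*>-\infty$ with $F(x)\ge F_*$ for all $x$; with $\Lambda=\{q:\nabla F(q)=0\}$, the set $F(\Lambda)\cap K$ is finite for every compact $K\subset\mathbb{R}$; and $\mathbb{E}[\nabla f(x,\xi)]=\nabla F(x)$ for all $x$. (b) There is $\lambda>0$ with $\|\nabla\varphi(y)-\nabla\varphi(x)\|_2\le\lambda\|x-y\|_2$ for all $x,y$; $\varphi(y)-\varphi(x)\le\langle\nabla\varphi(y),y-x\rangle$ for all $x,y$; $\lim_{\|x\|_2\to\infty}\varphi(x)=\infty$; and $\varphi(x)\ge\varphi_*>-\infty$ for all $x$. (c) $\alpha_0=0$, $\alpha_k>0$ for $k\ge1$, $\sum_k\alpha_k=\infty$ and $\sum_k\alpha_k^2<\infty$. (d) At least one of the following three settings holds. Setting 1: there is $L>0$ with $\|\nabla F(y)-\nabla F(x)\|_2\le L\|x-y\|_2$ for all $x,y$, and there are $\kappa,\tau,\sigma\ge0$ with $\mathbb{V}[\nabla f(x,\xi)]\le\kappa(F(x)-F_* )+\tau\|\nabla F(x)\|_2^2+\sigma^2$ for all $x$. Setting 2: $F$ is $(L_0,L_1)$-smooth; $\mathbb{V}[\nabla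 f(x,\xi)]\le\sigma^2$ for all $x$; and there is $\Delta>0$ with $\|\nabla\varphi(x)\|_2\le\Delta$ for all $x\in\mathbb{R}^d$. Setting 3: $F$ is $(L_0,L_1)$-smooth; there is $\Delta>0$ with $\|\nabla\varphi(x)\|_2\le\Delta$ for all $x\in\mathbb{R}^d$; $F=\frac1N\sum_{i=1}^N f_i$ and $f(q,\xi)=\frac{1}{|B_\xi|}\sum_{i\in B_\xi}f_i(q)$, $\nabla f(q,\xi)=\frac{1}{|B_{\xi}|}\sum_{i\in B_\xi}\nabla f_i(q)$, where $B_\xi\subset\{1,\dots,N\}$ is a (nonempty) random subset determined by $\xi$ and $\inf_{q}f_i(q)>-\infty$ for each $i$; $\mathbb{E}[\|\nabla f(x,\xi)-\nabla F(x)\|_2]\le\sigma$ for all $x$; and for each $\xi$, $f(\cdot,\xi)$ is $(L_0,L_1)$-smooth. Then $\sup_{k\ge0}\|p_k\|_2<\infty$ and $\sup_{k\ge0}\|q_k\|_2<\infty$ almost surely. Moreover, $\sup_{k\ge0}\mathbb{E}[F(q_k)]<\infty$.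
   Context: $(\Omega,\mathcal{F},\mathbb{P})$ is a probability space and $\{\xi_k\}_{k\ge0}$ is a sequence of independent, identically distributed random variables on it; $\xi$ denotes a generic variable with the same distribution. The scheme is $$p_{k+1}=p_k-\alpha_k\nabla f(q_k,\xi_k)-\alpha_k\gamma\nabla\varphi(p_k),\qquad q_{k+1}=q_k+\alpha_k\nabla\varphi(p_{k+1}),$$ with $p_0=0$ and $q_0\in\mathbb{R}^d$ arbitrary (deterministic). (It is associated with the Hamiltonian $H(p,q)=F(q)+\varphi(p)$.) $\mathbb{V}[\nabla f(x,\xi)]=\mathbb{E}[\|\nabla f(x,\xi)\|_2^2]-\|\nabla F(x)\|_2^2$. A differentiable function $G:\mathbb{R}^d\to\mathbb{R}$ is $(L_0,L_1)$-smooth (with constants $L_0\ge0$, $L_1>0$) if $\|\nabla G(x)-\nabla G(y)\|_2\le(L_0+L_1\|\nabla G(y)\|_2)\|x-y\|_2$ whenever $\|x-y\|_2\le 1/L_1$. *)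

theory Defs
  imports "HOL-Probability.Probability"
begin

definition gradient :: "('a::euclidean_space \<Rightarrow> real) \<Rightarrow> 'a \<Rightarrow> 'a"
  where "gradient F x = (THE D. GDERIV F x :> D)"

lemma gradient_works:
  fixes F :: "'a::euclidean_space \<Rightarrow> real"
  assumes "F differentiable (at x)"
  shows "GDERIV F x :> gradient F x"
proof -
  obtain F' where F': "(F has_derivative F') (at x)"
    using assms by (auto simp: differentiable_def)
  then have "linear F'"
    by (rule has_derivative_linear)
  then have "F' h = h \<bullet> adjoint F' 1" for h
    by (simp add: adjoint_works)
  then have "F' = (\<lambda>h. h \<bullet> adjoint F' 1)"
    by (rule ext)
  with F' have D: "GDERIV F x :> adjoint F' 1"
    unfolding gderiv_def by (rule back_subst[of "\<lambda>G. (F has_derivative G) (at x)"])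
  have "D1 = adjoint F' 1" if "GDERIV F x :> D1" for D1
  proof -
    have "(\<lambda>h. h \<bullet> D1) = (\<lambda>h. h \<bullet> adjoint F' 1)"
      by (rule has_derivative_unique[OF that[unfolded gderiv_def] D[unfolded gderiv_def]])
    then have "\<forall>h. h \<bullet> D1 = h \<bullet> adjoint F' 1"
      by (rule fun_cong[THEN allI])
    then show ?thesis
      unfolding vector_eq_ldot .
  qed
  with D show ?thesis
    unfolding gradient_def by (rule theI)
qed

definition L0L1_smooth :: "real \<Rightarrow> real \<Rightarrow> ('a::euclidean_space \<Rightarrow> real) \<Rightarrow> bool"
  where "L0L1_smooth L0 L1 G \<longleftrightarrow>
    0 \<le> L0 \<and> 0 < L1 \<and> (\<forall>x. G differentiable (at x)) \<and>
    (\<forall>x y. norm (x - y) \<le> 1 / L1 \<longrightarrow>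
      norm (gradient G x - gradient G y) \<le> (L0 + L1 * norm (gradient G y)) * norm (x - y))"

text \<open>The random variable \<open>X\<close> has the common law of the noise, and \<open>g x e\<close> is the stochastic
  gradient at \<open>x\<close> for the noise value \<open>e\<close>. The Bochner integral of a non-integrable function
  is \<open>0\<close>, so a bound on \<open>grad_variance\<close> carries its mathematical meaning only together with
  \<open>finite_second_moment\<close>.\<close>

definition finite_second_moment :: "'w measure \<Rightarrow> ('w \<Rightarrow> 'e) \<Rightarrow>
    ('a::euclidean_space \<Rightarrow> 'e \<Rightarrow> 'a) \<Rightarrow> 'a \<Rightarrow> bool"
  where "finite_second_moment M X g x \<longleftrightarrow> integrable M (\<lambda>\<omega>. (norm (g x (X \<omega>)))\<^sup>2)"

definition grad_variance :: "'w measure \<Rightarrow> ('w \<Rightarrow> 'e) \<Rightarrow>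
    ('a::euclidean_space \<Rightarrow> 'e \<Rightarrow> 'a) \<Rightarrow> ('a \<Rightarrow> real) \<Rightarrow> 'a \<Rightarrow> real"
  where "grad_variance M X g F x =
    (\<integral>\<omega>. (norm (g x (X \<omega>)))\<^sup>2 \<partial>M) - (norm (gradient F x))\<^sup>2"

end

theory Submission
  imports Defs
begin

text \<open>The energy \<open>V = 1 + (F q - F_low) + (\<phi> p - \<phi>_low)\<close> is almost a supermartingale. Convexity of
  \<open>\<phi>\<close> at the new momentum and a quadratic upper bound for \<open>F\<close> make the first-order terms cancel up
  to \<open>\<alpha> \<nabla>\<phi>(p) \<bullet> (\<nabla>F(q) - g)\<close>, which has mean zero, and the damping, which has the right
  sign. The remaining terms are of order \<open>\<alpha>\<^sup>2\<close> and their mean is at most a multiple of \<open>V\<close>, because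
  in each setting \<open>\<nabla>F\<close> and the noise are controlled by \<open>F - F_low\<close>. Hence the conditional mean of
  \<open>V\<close> grows by a factor of at most \<open>1 + C \<alpha>\<^sub>k\<^sup>2\<close> in step \<open>k\<close>. Since \<open>\<Sum>\<alpha>\<^sub>k\<^sup>2 < \<infinity>\<close>, the means of \<open>V\<close>
  stay bounded, a maximal inequality bounds \<open>V\<close> along almost every path, and coercivity of \<open>F\<close> and
  \<open>\<phi>\<close> bounds the iterates.\<close>

section \<open>Recursions driven by independent noise\<close>

text \<open>\<open>Y k\<close> depends only on the noise before time \<open>k\<close>, hence is
  independent of \<open>\<xi> k\<close>. The joint law is then a product, Tonelli gives an iterated
  integral, and in its inner integral \<open>\<xi> k\<close> may be exchanged for \<open>X\<close>.
  This takes the place of conditional expectations given the past.\<close>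

lemma (in prob_space) noise_recursion_independent:
  fixes \<xi> :: "nat \<Rightarrow> 'a \<Rightarrow> 'e" and Y :: "nat \<Rightarrow> 'a \<Rightarrow> 's"
  assumes indep: "indep_vars (\<lambda>_. S) \<xi> UNIV"
    and X: "X \<in> M \<rightarrow>\<^sub>M S" and distr: "\<And>k. distr M S (\<xi> k) = distr M S X"
    and Y_0: "\<And>\<omega>. \<omega> \<in> space M \<Longrightarrow> Y 0 \<omega> = y0" and y0: "y0 \<in> space N"
    and Y_Suc: "\<And>k \<omega>. \<omega> \<in> space M \<Longrightarrow> Y (Suc k) \<omega> = T k (Y k \<omega>, \<xi> k \<omega>)"
    and T: "\<And>k. T k \<in> N \<Otimes>\<^sub>M S \<rightarrow>\<^sub>M N"
  shows noise_recursion_measurable: "Y k \<in> M \<rightarrow>\<^sub>M N"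
    and noise_recursion_nn_integral: "Q \<in> borel_measurable (N \<Otimes>\<^sub>M S) \<Longrightarrow>
      (\<integral>\<^sup>+\<omega>. Q (Y k \<omega>, \<xi> k \<omega>) \<partial>M) = (\<integral>\<^sup>+\<omega>. (\<integral>\<^sup>+\<omega>'. Q (Y k \<omega>, X \<omega>') \<partial>M) \<partial>M)"
proof -
  \<comment> \<open>The state as a function of a whole noise path. As \<open>st j\<close> reads only
    coordinates below \<open>j\<close>, it is measurable on any finite product over
    \<open>{..<m}\<close> with \<open>j \<le> m\<close>.\<close>
  define st where "st = (\<lambda>k w. rec_nat y0 (\<lambda>k s. T k (s, w k)) k)"
  have st_simps: "st 0 w = y0" "st (Suc k) w = T k (st k w, w k)" for k w
    by (simp_all add: st_def)
  have st_meas: "j \<le> m \<Longrightarrow> st j \<in> PiM {..<m} (\<lambda>_. S) \<rightarrow>\<^sub>M N" for j m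
  proof (induction j)
    case 0
    have "(\<lambda>_. y0) \<in> PiM {..<m} (\<lambda>_. S) \<rightarrow>\<^sub>M N"
      using y0 by simp
    then show ?case
      by (simp add: st_simps cong: measurable_cong)
  next
    case (Suc j)
    then have "(\<lambda>w. T j (st j w, w j)) \<in> PiM {..<m} (\<lambda>_. S) \<rightarrow>\<^sub>M N"
      by (intro measurable_compose[OF _ T] measurable_Pair measurable_component_singleton) auto
    then show ?case
      by (simp add: st_simps cong: measurable_cong)
  qed
  define past where "past = (\<lambda>\<omega>. restrict (\<lambda>i. \<xi> i \<omega>) {..<k})"
  have \<xi>_meas: "\<xi> i \<in> M \<rightarrow>\<^sub>M S" for i
    using indep by (auto simp: indep_vars_def)
  have past_meas: "past \<in> M \<rightarrow>\<^sub>M PiM {..<k} (\<lambda>_. S)"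
    unfolding past_def by (intro measurable_restrict \<xi>_meas)
  have Y_past: "j \<le> k \<Longrightarrow> Y j \<omega> = st j (past \<omega>)" if "\<omega> \<in> space M" for j \<omega>
    by (induction j) (use that in \<open>auto simp: Y_0 Y_Suc st_simps past_def\<close>)
  have "(\<lambda>\<omega>. st k (past \<omega>)) \<in> M \<rightarrow>\<^sub>M N"
    by (rule measurable_compose[OF past_meas st_meas]) simp
  then show Y_meas: "Y k \<in> M \<rightarrow>\<^sub>M N"
    using Y_past by (subst measurable_cong[where g = "\<lambda>\<omega>. st k (past \<omega>)"]) auto
  assume Q: "Q \<in> borel_measurable (N \<Otimes>\<^sub>M S)"
  \<comment> \<open>A path with the single coordinate \<open>k\<close>, since independence of
    disjoint blocks of an independent family is phrased for restrictions to index sets.\<close>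
  define now where "now = (\<lambda>\<omega>. restrict (\<lambda>i. \<xi> i \<omega>) {k})"
  define P where "P = PiM {..<k} (\<lambda>_. S)"
  define R where "R = PiM {k} (\<lambda>_. S)"
  have past[measurable]: "past \<in> M \<rightarrow>\<^sub>M P" and now[measurable]: "now \<in> M \<rightarrow>\<^sub>M R"
    unfolding P_def R_def now_def by (intro past_meas measurable_restrict \<xi>_meas)+
  have now_k: "now \<omega> k = \<xi> k \<omega>" for \<omega>
    by (simp add: now_def)
  have "indep_var P past R now"
    unfolding past_def now_def P_def R_def by (rule indep_var_restrict[OF indep]) auto
  then have joint: "distr M P past \<Otimes>\<^sub>M distr M R now = distr M (P \<Otimes>\<^sub>M R) (\<lambda>\<omega>. (past \<omega>, now \<omega>))"
    by (simp add: indep_var_distribution_eq)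
  interpret D: prob_space "distr M R now"
    by (rule prob_space_distr) simp
  have [measurable]: "st k \<in> P \<rightarrow>\<^sub>M N" "(\<lambda>v. v k) \<in> R \<rightarrow>\<^sub>M S"
    unfolding P_def R_def by (auto intro: st_meas)
  note Q[measurable] \<xi>_meas[measurable] X[measurable]
  define Q' where "Q' = (\<lambda>z. Q (st k (fst z), snd z k))"
  have Q'[measurable]: "Q' \<in> borel_measurable (P \<Otimes>\<^sub>M R)"
    unfolding Q'_def by measurable
  have "(\<integral>\<^sup>+\<omega>. Q (Y k \<omega>, \<xi> k \<omega>) \<partial>M) = (\<integral>\<^sup>+\<omega>. Q' (past \<omega>, now \<omega>) \<partial>M)"
    by (intro nn_integral_cong) (simp add: Q'_def Y_past now_k)
  also have "\<dots> = (\<integral>\<^sup>+ z. Q' z \<partial>distr M (P \<Otimes>\<^sub>M R) (\<lambda>\<omega>. (past \<omega>, now \<omega>)))"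
    by (intro nn_integral_distr[symmetric]) measurable
  also have "\<dots> = (\<integral>\<^sup>+ w. (\<integral>\<^sup>+ v. Q' (w, v) \<partial>distr M R now) \<partial>distr M P past)"
    unfolding joint[symmetric] by (rule D.nn_integral_fst[symmetric]) simp
  also have "\<dots> = (\<integral>\<^sup>+ \<omega>. (\<integral>\<^sup>+ v. Q' (past \<omega>, v) \<partial>distr M R now) \<partial>M)"
    by (rule nn_integral_distr) simp_all
  also have "\<dots> = (\<integral>\<^sup>+\<omega>. (\<integral>\<^sup>+\<omega>'. Q (Y k \<omega>, X \<omega>') \<partial>M) \<partial>M)"
  proof (rule nn_integral_cong)
    \<comment> \<open>For a fixed past the inner integral depends only on the law of
      \<open>\<xi> k\<close>, which is that of \<open>X\<close>.\<close>
    fix \<omega> assume \<omega>: "\<omega> \<in> space M"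
    have [measurable]: "past \<omega> \<in> space P" "Y k \<omega> \<in> space N"
      using measurable_space[OF past \<omega>] measurable_space[OF Y_meas \<omega>] .
    have "(\<integral>\<^sup>+ v. Q' (past \<omega>, v) \<partial>distr M R now) = (\<integral>\<^sup>+\<omega>'. Q (Y k \<omega>, \<xi> k \<omega>') \<partial>M)"
      using \<omega> by (subst nn_integral_distr) (simp_all add: Q'_def Y_past now_k)
    also have "\<dots> = (\<integral>\<^sup>+e. Q (Y k \<omega>, e) \<partial>distr M S (\<xi> k))"
      by (subst nn_integral_distr) simp_all
    also have "\<dots> = (\<integral>\<^sup>+\<omega>'. Q (Y k \<omega>, X \<omega>') \<partial>M)"
      unfolding distr by (subst nn_integral_distr) simp_all
    finally show "(\<integral>\<^sup>+ v. Q' (past \<omega>, v) \<partial>distr M R now) = (\<integral>\<^sup>+\<omega>'. Q (Y k \<omega>, X \<omega>') \<partial>M)" .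
  qed
  finally show "(\<integral>\<^sup>+\<omega>. Q (Y k \<omega>, \<xi> k \<omega>) \<partial>M) = (\<integral>\<^sup>+\<omega>. (\<integral>\<^sup>+\<omega>'. Q (Y k \<omega>, X \<omega>') \<partial>M) \<partial>M)" .
qed

text \<open>A discrete Gronwall argument: each step multiplies the mean by at most
  \<open>1 + b k \<le> exp (b k)\<close>, and the product of these factors is the exponential of a
  partial sum, which summability bounds uniformly in time. Values in \<open>ennreal\<close> spare
  the induction any integrability claim.\<close>

lemma (in prob_space) noise_recursion_expectation_bound:
  fixes \<xi> :: "nat \<Rightarrow> 'a \<Rightarrow> 'e" and Y :: "nat \<Rightarrow> 'a \<Rightarrow> 's" and V :: "'s \<Rightarrow> ennreal"
  assumes indep: "indep_vars (\<lambda>_. S) \<xi> UNIV"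
    and X: "X \<in> M \<rightarrow>\<^sub>M S" and distr: "\<And>k. distr M S (\<xi> k) = distr M S X"
    and Y_0: "\<And>\<omega>. \<omega> \<in> space M \<Longrightarrow> Y 0 \<omega> = y0" and y0: "y0 \<in> space N"
    and Y_Suc: "\<And>k \<omega>. \<omega> \<in> space M \<Longrightarrow> Y (Suc k) \<omega> = T k (Y k \<omega>, \<xi> k \<omega>)"
    and T: "\<And>k. T k \<in> N \<Otimes>\<^sub>M S \<rightarrow>\<^sub>M N"
    and V: "V \<in> borel_measurable N"
    and growth: "\<And>k y. y \<in> space N \<Longrightarrow> (\<integral>\<^sup>+\<omega>. V (T k (y, X \<omega>)) \<partial>M) \<le> ennreal (1 + b k) * V y"
    and b: "\<And>k. 0 \<le> b k" "summable b"
  shows "(\<integral>\<^sup>+\<omega>. V (Y k \<omega>) \<partial>M) \<le> ennreal (exp (suminf b)) * V y0"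
proof -
  note rec = indep X distr Y_0 y0 Y_Suc T
  note Y_meas = noise_recursion_measurable[OF rec]
  have VT: "(\<lambda>z. V (T k z)) \<in> borel_measurable (N \<Otimes>\<^sub>M S)" for k
    by (rule measurable_compose[OF T V])
  have "(\<integral>\<^sup>+\<omega>. V (Y k \<omega>) \<partial>M) \<le> ennreal (exp (\<Sum>j<k. b j)) * V y0" for k
  proof (induction k)
    case 0
    have "(\<integral>\<^sup>+\<omega>. V (Y 0 \<omega>) \<partial>M) = (\<integral>\<^sup>+\<omega>. V y0 \<partial>M)"
      by (intro nn_integral_cong) (simp add: Y_0)
    then show ?case
      by (simp add: emeasure_space_1)
  next
    case (Suc k)
    have "(\<integral>\<^sup>+\<omega>. V (Y (Suc k) \<omega>) \<partial>M) = (\<integral>\<^sup>+\<omega>. V (T k (Y k \<omega>, \<xi> k \<omega>)) \<partial>M)"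
      by (intro nn_integral_cong) (simp add: Y_Suc)
    also have "\<dots> = (\<integral>\<^sup>+\<omega>. (\<integral>\<^sup>+\<omega>'. V (T k (Y k \<omega>, X \<omega>')) \<partial>M) \<partial>M)"
      by (rule noise_recursion_nn_integral[OF rec VT])
    also have "\<dots> \<le> (\<integral>\<^sup>+\<omega>. ennreal (1 + b k) * V (Y k \<omega>) \<partial>M)"
      using measurable_space[OF Y_meas] by (intro nn_integral_mono growth)
    also have "\<dots> = ennreal (1 + b k) * (\<integral>\<^sup>+\<omega>. V (Y k \<omega>) \<partial>M)"
      by (intro nn_integral_cmult measurable_compose[OF Y_meas V])
    also have "\<dots> \<le> ennreal (exp (b k)) * (ennreal (exp (\<Sum>j<k. b j)) * V y0)"
      by (intro mult_mono Suc ennreal_leI exp_ge_add_one_self) auto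
    also have "\<dots> = ennreal (exp (\<Sum>j<Suc k. b j)) * V y0"
      by (simp add: exp_add ennreal_mult' mult_ac)
    finally show ?case .
  qed
  also have "ennreal (exp (\<Sum>j<k. b j)) * V y0 \<le> ennreal (exp (suminf b)) * V y0"
    using b by (intro mult_right_mono ennreal_leI) (auto intro: sum_le_suminf)
  finally show ?thesis .
qed

text \<open>Freezing the recursion as soon as \<open>V \<ge> c\<close> turns the event that \<open>V\<close> ever reaches \<open>c\<close>
  into an event about a single time, to which Markov's inequality applies.\<close>

lemma (in prob_space) noise_recursion_AE_bounded:
  fixes \<xi> :: "nat \<Rightarrow> 'a \<Rightarrow> 'e" and Y :: "nat \<Rightarrow> 'a \<Rightarrow> 's" and V :: "'s \<Rightarrow> ennreal"
  assumes indep: "indep_vars (\<lambda>_. S) \<xi> UNIV"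
    and X: "X \<in> M \<rightarrow>\<^sub>M S" and distr: "\<And>k. distr M S (\<xi> k) = distr M S X"
    and Y_0: "\<And>\<omega>. \<omega> \<in> space M \<Longrightarrow> Y 0 \<omega> = y0" and y0: "y0 \<in> space N"
    and Y_Suc: "\<And>k \<omega>. \<omega> \<in> space M \<Longrightarrow> Y (Suc k) \<omega> = T k (Y k \<omega>, \<xi> k \<omega>)"
    and T: "\<And>k. T k \<in> N \<Otimes>\<^sub>M S \<rightarrow>\<^sub>M N"
    and V: "V \<in> borel_measurable N"
    and growth: "\<And>k y. y \<in> space N \<Longrightarrow> (\<integral>\<^sup>+\<omega>. V (T k (y, X \<omega>)) \<partial>M) \<le> ennreal (1 + b k) * V y"
    and b: "\<And>k. 0 \<le> b k" "summable b"
    and V_y0: "V y0 < \<infinity>"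
  shows "AE \<omega> in M. \<exists>c::nat. \<forall>k. V (Y k \<omega>) \<le> of_nat c"
proof -
  note Y_meas[measurable] = noise_recursion_measurable[OF indep X distr Y_0 y0 Y_Suc T]
  note V[measurable] and T[measurable]
  define K where "K = ennreal (exp (suminf b)) * V y0"
  have K_fin: "K < \<infinity>"
    using V_y0 by (simp add: K_def ennreal_mult_less_top)
  define A where "A = (\<lambda>(c::nat) n. {\<omega>\<in>space M. \<exists>k\<le>n. of_nat c \<le> V (Y k \<omega>)})"
  have A_sets[measurable]: "A c n \<in> sets M" for c n
    unfolding A_def by measurable
  have A_bound: "of_nat c * emeasure M (A c n) \<le> K" for c n
  proof -
    \<comment> \<open>Once \<open>V\<close> has reached \<open>c\<close> the state no longer moves.
      Such a step keeps \<open>V\<close> fixed and \<open>1 \<le> 1 + b k\<close>, so the growth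
      condition passes from \<open>T\<close> to \<open>T'\<close>. The path \<open>Y'\<close> is
      rebuilt from \<open>T'\<close>, so that it is again a noise recursion and the expectation
      bound applies to it.\<close>
    define T' where "T' = (\<lambda>k z. if of_nat c \<le> V (fst z) then fst z else T k z)"
    define Y' where "Y' = (\<lambda>k \<omega>. rec_nat y0 (\<lambda>k y. T' k (y, \<xi> k \<omega>)) k)"
    have Y'_simps: "Y' 0 \<omega> = y0" "Y' (Suc k) \<omega> = T' k (Y' k \<omega>, \<xi> k \<omega>)" for k \<omega>
      by (simp_all add: Y'_def)
    have T'[measurable]: "T' k \<in> N \<Otimes>\<^sub>M S \<rightarrow>\<^sub>M N" for k
      unfolding T'_def by measurable
    have growth': "(\<integral>\<^sup>+\<omega>. V (T' k (y, X \<omega>)) \<partial>M) \<le> ennreal (1 + b k) * V y"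
      if y: "y \<in> space N" for k y
    proof (cases "of_nat c \<le> V y")
      case True
      have "1 * V y \<le> ennreal (1 + b k) * V y"
        using b(1)[of k] by (intro mult_right_mono) (auto simp: ennreal_1[symmetric] simp del: ennreal_1)
      with True show ?thesis
        by (simp add: T'_def emeasure_space_1)
    next
      case False
      then show ?thesis
        using growth[OF y, of k] by (simp add: T'_def)
    qed
    note rec' = indep X distr Y'_simps(1) y0 Y'_simps(2) T'
    have Y'_meas[measurable]: "Y' k \<in> M \<rightarrow>\<^sub>M N" for k
      by (rule noise_recursion_measurable[OF rec'])
    \<comment> \<open>Only times strictly before \<open>k\<close> are constrained, so the two paths
      still agree at the first time the level is reached; from then on \<open>Y'\<close> stays
      there.\<close>
    have frozen: "(\<forall>j<k. V (Y j \<omega>) < of_nat c) \<longrightarrow> Y' k \<omega> = Y k \<omega>" if "\<omega> \<in> space M" for k \<omega>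
      by (induction k) (use that in \<open>auto simp: Y'_simps Y_0 Y_Suc T'_def not_le\<close>)
    have reached: "(\<exists>j\<le>k. of_nat c \<le> V (Y j \<omega>)) \<longrightarrow> of_nat c \<le> V (Y' k \<omega>)"
      if "\<omega> \<in> space M" for k \<omega>
    proof (induction k)
      case 0
      then show ?case using that by (simp add: Y'_simps Y_0)
    next
      case (Suc k)
      show ?case
      proof (cases "\<exists>j\<le>k. of_nat c \<le> V (Y j \<omega>)")
        case True
        with Suc show ?thesis by (simp add: Y'_simps T'_def)
      next
        case False
        then have "Y' (Suc k) \<omega> = Y (Suc k) \<omega>"
          using frozen[OF that, of "Suc k"] by (meson not_le less_Suc_eq_le)
        with False show ?thesis by (auto simp: le_Suc_eq)
      qed
    qed
    have "of_nat c * emeasure M (A c n) = (\<integral>\<^sup>+\<omega>. of_nat c * indicator (A c n) \<omega> \<partial>M)"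
      by (simp add: nn_integral_cmult_indicator)
    also have "\<dots> \<le> (\<integral>\<^sup>+\<omega>. V (Y' n \<omega>) \<partial>M)"
      using reached by (intro nn_integral_mono) (auto simp: A_def indicator_def)
    also have "\<dots> \<le> K"
      unfolding K_def by (rule noise_recursion_expectation_bound[OF rec' V growth' b])
    finally show ?thesis .
  qed
  \<comment> \<open>The paths along which \<open>V\<close> reaches every level. The bound
    \<open>K\<close> is the same for all times and levels, so it survives the limit in
    \<open>n\<close>; then \<open>c * prob E\<close> is bounded in \<open>c\<close>, which forces
    \<open>prob E = 0\<close>.\<close>
  define E where "E = (\<Inter>c. \<Union>n. A c n)"
  have E_sets[measurable]: "E \<in> sets M"
    unfolding E_def by measurable
  have E_bound: "of_nat c * emeasure M E \<le> K" for c
  proof -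
    have "emeasure M E \<le> emeasure M (\<Union>n. A c n)"
      unfolding E_def by (rule emeasure_mono) auto
    also have "\<dots> = (SUP n. emeasure M (A c n))"
      by (intro SUP_emeasure_incseq[symmetric]) (auto simp: incseq_def A_def intro: order_trans)
    finally have "of_nat c * emeasure M E \<le> of_nat c * (SUP n. emeasure M (A c n))"
      by (rule mult_left_mono) simp
    also have "\<dots> = (SUP n. of_nat c * emeasure M (A c n))"
      by (simp add: SUP_mult_left_ennreal)
    also have "\<dots> \<le> K"
      by (intro SUP_least A_bound)
    finally show ?thesis .
  qed
  have "real c * prob E \<le> enn2real K" for c :: nat
  proof -
    have "ennreal (real c * prob E) \<le> K"
      using E_bound[of c] by (simp add: emeasure_eq_measure ennreal_mult' ennreal_of_nat_eq_real_of_nat)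
    then show ?thesis
      using K_fin by (cases K) (auto simp: ennreal_le_iff)
  qed
  then have "\<not> prob E > 0"
    using reals_Archimedean3[of "prob E"] by (meson not_le)
  then have "E \<in> null_sets M"
    by (auto simp: null_sets_def emeasure_eq_measure zero_less_measure_iff)
  then show ?thesis
  proof (rule AE_I')
    show "{\<omega> \<in> space M. \<not> (\<exists>c. \<forall>k. V (Y k \<omega>) \<le> of_nat c)} \<subseteq> E"
      by (auto simp: E_def A_def not_le) (meson le_less order_refl)
  qed
qed

section \<open>Smoothness\<close>

lemma gradient_eqI:
  assumes "GDERIV G x :> D" shows "gradient G x = D"
proof -
  have "G differentiable (at x)"
    using assms by (auto simp: gderiv_def differentiable_def)
  then have "GDERIV G x :> gradient G x"
    by (rule gradient_works)
  then have "(\<lambda>h. h \<bullet> gradient G x) = (\<lambda>h. h \<bullet> D)"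
    using assms unfolding gderiv_def by (rule has_derivative_unique)
  then have "\<forall>h. h \<bullet> gradient G x = h \<bullet> D"
    by (rule fun_cong[THEN allI])
  then show ?thesis
    unfolding vector_eq_ldot .
qed

text \<open>The mean value theorem on the segment from \<open>x\<close> to \<open>x + w\<close>
  yields a gradient at an intermediate point, and Cauchy-Schwarz controls its deviation from the
  gradient at \<open>x\<close>. Using a uniform bound instead of an integral remainder loses the
  usual factor 1/2 in the quadratic terms below.\<close>

lemma expansion_upper_bound:
  fixes G :: "'a::euclidean_space \<Rightarrow> real"
  assumes diff: "\<And>x. G differentiable (at x)"
    and B: "\<And>t. 0 \<le> t \<Longrightarrow> t \<le> 1 \<Longrightarrow> norm (gradient G (x + t *\<^sub>R w) - gradient G x) \<le> B"
  shows "G (x + w) \<le> G x + gradient G x \<bullet> w + B * norm w"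
proof -
  have "((\<lambda>t. G (x + t *\<^sub>R w)) has_derivative (\<lambda>s. (s *\<^sub>R w) \<bullet> gradient G (x + t *\<^sub>R w)))
      (at t within {0..1})" for t :: real
  proof -
    have "((\<lambda>t. x + t *\<^sub>R w) has_derivative (\<lambda>s. s *\<^sub>R w)) (at t within {0..1})"
      by (auto intro!: derivative_eq_intros)
    moreover have "(G has_derivative (\<lambda>h. h \<bullet> gradient G (x + t *\<^sub>R w))) (at (x + t *\<^sub>R w))"
      using gradient_works[OF diff] by (simp add: gderiv_def)
    ultimately show ?thesis
      by (rule has_derivative_compose)
  qed
  from mvt_very_simple[OF _ this] obtain t :: real where t: "0 \<le> t" "t \<le> 1"
    and "G (x + 1 *\<^sub>R w) - G (x + 0 *\<^sub>R w) = ((1 - 0) *\<^sub>R w) \<bullet> gradient G (x + t *\<^sub>R w)"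
    by force
  then have "G (x + w) = G x + gradient G x \<bullet> w + (gradient G (x + t *\<^sub>R w) - gradient G x) \<bullet> w"
    by (simp add: inner_diff_left inner_commute[of w])
  also have "(gradient G (x + t *\<^sub>R w) - gradient G x) \<bullet> w \<le> B * norm w"
    using B[OF t] by (meson mult_right_mono norm_cauchy_schwarz norm_ge_zero order_trans)
  finally show ?thesis by simp
qed

lemma lipschitz_gradient_expansion:
  fixes G :: "'a::euclidean_space \<Rightarrow> real"
  assumes diff: "\<And>x. G differentiable (at x)" and "0 \<le> L"
    and lip: "\<And>x y. norm (gradient G y - gradient G x) \<le> L * norm (x - y)"
  shows "G (x + w) \<le> G x + gradient G x \<bullet> w + L * (norm w)\<^sup>2"
proof -
  have "norm (gradient G (x + t *\<^sub>R w) - gradient G x) \<le> L * norm w" if "0 \<le> t" "t \<le> 1" for t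
  proof -
    have "L * (t * norm w) \<le> L * (1 * norm w)"
      using that \<open>0 \<le> L\<close> by (intro mult_left_mono mult_right_mono) auto
    then show ?thesis
      using lip[of "x + t *\<^sub>R w" x] that by simp
  qed
  from expansion_upper_bound[OF diff this] show ?thesis
    by (simp add: power2_eq_square mult_ac)
qed

text \<open>A gradient step of size \<open>1 / (2 * L)\<close>, which minimizes the quadratic upper
  bound, lowers \<open>G\<close> by at least the squared gradient norm over \<open>4 * L\<close>,
  yet \<open>G\<close> cannot fall below \<open>m\<close>.\<close>

lemma lipschitz_gradient_bound:
  fixes G :: "'a::euclidean_space \<Rightarrow> real"
  assumes diff: "\<And>x. G differentiable (at x)" and "0 < L"
    and lip: "\<And>x y. norm (gradient G y - gradient G x) \<le> L * norm (x - y)"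
    and low: "\<And>x. m \<le> G x"
  shows "(norm (gradient G x))\<^sup>2 \<le> 4 * L * (G x - m)"
proof -
  define D where "D = gradient G x"
  define w where "w = - (1 / (2 * L)) *\<^sub>R D"
  have "m \<le> G (x + w)"
    by (rule low)
  also have "\<dots> \<le> G x + D \<bullet> w + L * (norm w)\<^sup>2"
    unfolding D_def using \<open>0 < L\<close> by (intro lipschitz_gradient_expansion diff lip) auto
  also have "D \<bullet> w = - (norm D)\<^sup>2 / (2 * L)"
    by (simp add: w_def power2_norm_eq_inner)
  also have "L * (norm w)\<^sup>2 = (norm D)\<^sup>2 / (4 * L)"
    using \<open>0 < L\<close> by (simp add: w_def power2_eq_square field_simps)
  finally show ?thesis
    using \<open>0 < L\<close> by (simp add: D_def field_simps)
qed

section \<open>Functions satisfying (L0, L1)-smoothness\<close>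

lemma L0L1_smooth_expansion:
  fixes G :: "'a::euclidean_space \<Rightarrow> real"
  assumes G: "L0L1_smooth L0 L1 G" and w: "norm w \<le> 1 / L1"
  shows "G (x + w) \<le> G x + gradient G x \<bullet> w + (L0 + L1 * norm (gradient G x)) * (norm w)\<^sup>2"
proof -
  let ?K = "L0 + L1 * norm (gradient G x)"
  have pos: "0 \<le> L0" "0 < L1" and diff: "\<And>x. G differentiable (at x)"
    and lip: "\<And>x y. norm (x - y) \<le> 1 / L1 \<Longrightarrow>
      norm (gradient G x - gradient G y) \<le> (L0 + L1 * norm (gradient G y)) * norm (x - y)"
    using G by (auto simp: L0L1_smooth_def)
  have "norm (gradient G (x + t *\<^sub>R w) - gradient G x) \<le> ?K * norm w" if t: "0 \<le> t" "t \<le> 1" for t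
  proof -
    have tw: "t * norm w \<le> 1 * norm w"
      using t by (intro mult_right_mono) auto
    then have "norm (gradient G (x + t *\<^sub>R w) - gradient G x) \<le> ?K * (t * norm w)"
      using lip[of "x + t *\<^sub>R w" x] t w by simp
    also have "\<dots> \<le> ?K * norm w"
      using tw pos by (intro mult_left_mono) auto
    finally show ?thesis .
  qed
  from expansion_upper_bound[OF diff this] show ?thesis
    by (simp add: power2_eq_square mult_ac)
qed

text \<open>The expansion is valid only up to radius \<open>1 / L1\<close>, so the descent step has
  fixed length \<open>1 / (2 * L1)\<close> and the gradient enters linearly, not squared. At half
  the radius the quadratic term consumes only half of the first-order decrease
  \<open>d / (2 * L1)\<close>.\<close>

lemma L0L1_smooth_gradient_bound:
  fixes G :: "'a::euclidean_space \<Rightarrow> real"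
  assumes G: "L0L1_smooth L0 L1 G" and low: "\<And>x. m \<le> G x"
  shows "norm (gradient G x) \<le> 4 * L1 * (G x - m) + L0 / L1"
proof -
  have pos: "0 \<le> L0" "0 < L1"
    using G by (auto simp: L0L1_smooth_def)
  define d where "d = norm (gradient G x)"
  define w where "w = - (1 / (2 * L1)) *\<^sub>R sgn (gradient G x)"
  have nw: "norm w \<le> 1 / (2 * L1)"
    using pos by (simp add: w_def norm_sgn)
  have w2: "(norm w)\<^sup>2 \<le> (1 / (2 * L1))\<^sup>2"
    by (rule power_mono[OF nw]) simp
  have "m \<le> G (x + w)"
    by (rule low)
  also have "\<dots> \<le> G x + gradient G x \<bullet> w + (L0 + L1 * d) * (norm w)\<^sup>2"
    unfolding d_def using nw pos by (intro L0L1_smooth_expansion[OF G]) (simp add: field_simps)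
  also have "gradient G x \<bullet> w = - d / (2 * L1)"
    by (cases "gradient G x = 0") (simp_all add: w_def d_def sgn_div_norm dot_square_norm power2_eq_square)
  also have "(L0 + L1 * d) * (norm w)\<^sup>2 \<le> (L0 + L1 * d) * (1 / (2 * L1))\<^sup>2"
    using w2 pos by (intro mult_left_mono) (auto simp: d_def)
  finally have "m \<le> G x + - d / (2 * L1) + (L0 + L1 * d) * (1 / (2 * L1))\<^sup>2"
    by simp
  moreover have "(L0 + L1 * d) * (1 / (2 * L1))\<^sup>2 = (L0 / L1 + d) / (4 * L1)"
    using pos by (simp add: power2_eq_square divide_simps)
  ultimately have "d / (2 * L1) \<le> (G x - m) + (L0 / L1 + d) / (4 * L1)"
    by simp
  then have "d / (2 * L1) * (4 * L1) \<le> ((G x - m) + (L0 / L1 + d) / (4 * L1)) * (4 * L1)"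
    using pos by (intro mult_right_mono) auto
  moreover have "d / (2 * L1) * (4 * L1) = 2 * d"
    "((G x - m) + (L0 / L1 + d) / (4 * L1)) * (4 * L1) = (G x - m) * (4 * L1) + (L0 / L1 + d)"
    using pos by (simp, simp add: field_simps)
  ultimately show ?thesis
    unfolding d_def[symmetric] by (simp add: algebra_simps)
qed

text \<open>The additive constant is absorbed by the summand 1, because the growth of the energy
  must be bounded by a multiple of the energy itself.\<close>

lemma L0L1_smooth_gradient_le_energy:
  fixes G :: "'a::euclidean_space \<Rightarrow> real"
  assumes G: "L0L1_smooth L0 L1 G" and low: "\<And>x. m \<le> G x"
  shows "norm (gradient G x) \<le> (4 * L1 + L0 / L1) * (1 + (G x - m))"
proof -
  have "0 \<le> 4 * L1 + (G x - m) * (L0 / L1)"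
    using low[of x] G by (simp add: L0L1_smooth_def)
  then show ?thesis
    using L0L1_smooth_gradient_bound[OF G low, of x] by (simp add: algebra_simps)
qed

text \<open>Over a distance \<open>1 / L1\<close> the shifted function grows by at most a constant
  factor, and a displacement of length \<open>R\<close> is covered by finitely many such pieces
  along a straight line.\<close>

lemma L0L1_smooth_growth:
  fixes G :: "'a::euclidean_space \<Rightarrow> real"
  assumes G: "L0L1_smooth L0 L1 G" and low: "\<And>x. m \<le> G x"
  shows "\<exists>C\<ge>0. \<forall>x w. norm w \<le> R \<longrightarrow> 1 + (G (x + w) - m) \<le> C * (1 + (G x - m))"
proof -
  have pos: "0 \<le> L0" "0 < L1"
    using G by (auto simp: L0L1_smooth_def)
  \<comment> \<open>The 9 is 1 plus the 8 coming from the gradient bound, inserted into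
    \<open>2 * d / L1\<close>. That bound also gives two of the three copies of
    \<open>L0 / L1\<^sup>2\<close>; the expansion gives the third.\<close>
  define c where "c = 9 + 3 * L0 / L1\<^sup>2"
  have c: "c \<ge> 0"
    using pos by (simp add: c_def)
  have local: "1 + (G (x + w) - m) \<le> c * (1 + (G x - m))" if w: "norm w \<le> 1 / L1" for x w
  proof -
    define d where "d = norm (gradient G x)"
    define u where "u = G x - m"
    have u: "0 \<le> u" and d: "0 \<le> d"
      using low[of x] by (auto simp: u_def d_def)
    have "gradient G x \<bullet> w \<le> d * (1 / L1)"
      using norm_cauchy_schwarz[of "gradient G x" w] mult_left_mono[OF w d] by (simp add: d_def)
    moreover have "(L0 + L1 * d) * (norm w)\<^sup>2 \<le> (L0 + L1 * d) * (1 / L1)\<^sup>2"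
      using w pos d by (intro mult_left_mono power_mono) auto
    ultimately have "G (x + w) - m \<le> u + d * (1 / L1) + (L0 + L1 * d) * (1 / L1)\<^sup>2"
      using L0L1_smooth_expansion[OF G w, of x] by (simp add: u_def d_def)
    also have "\<dots> = u + 2 * d / L1 + L0 / L1\<^sup>2"
      using pos by (simp add: field_simps power2_eq_square)
    also have "2 * d / L1 \<le> 2 * (4 * L1 * u + L0 / L1) / L1"
      using L0L1_smooth_gradient_bound[OF G low, of x] pos
      unfolding d_def[symmetric] u_def[symmetric] by (intro divide_right_mono mult_left_mono) auto
    also have "\<dots> = 8 * u + 2 * L0 / L1\<^sup>2"
      using pos by (simp add: field_simps power2_eq_square)
    finally have *: "1 + (G (x + w) - m) \<le> 1 + 9 * u + 3 * (L0 / L1\<^sup>2)"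
      by simp
    define r where "r = 3 * (L0 / L1\<^sup>2)"
    have "c = 9 + r" "0 \<le> u * r"
      using u pos by (simp_all add: c_def r_def)
    then have "1 + 9 * u + 3 * (L0 / L1\<^sup>2) \<le> c * (1 + u)"
      unfolding r_def[symmetric] by (simp add: algebra_simps)
    with * show ?thesis
      by (simp add: u_def)
  qed
  have "1 + (G (x + w) - m) \<le> c ^ n * (1 + (G x - m))" if "norm w \<le> n / L1" for n :: nat and x w
    using that
  proof (induction n arbitrary: w)
    case 0
    then show ?case by simp
  next
    case (Suc n)
    \<comment> \<open>The cut point after \<open>n\<close> of \<open>n + 1\<close> equal pieces of
      \<open>w\<close>: the induction hypothesis reaches \<open>x + v\<close>, and the local bound
      covers the last piece.\<close>
    define v where "v = (real n / real (Suc n)) *\<^sub>R w"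
    have "1 - real n / real (Suc n) = 1 / real (Suc n)"
      by (simp add: field_simps)
    moreover have "w - v = (1 - real n / real (Suc n)) *\<^sub>R w"
      by (simp add: v_def scaleR_left_diff_distrib)
    ultimately have wv: "w - v = (1 / real (Suc n)) *\<^sub>R w"
      by simp
    have nv: "norm v \<le> real n / L1"
    proof -
      have "norm v = real n / real (Suc n) * norm w"
        by (simp add: v_def)
      also have "\<dots> \<le> real n / real (Suc n) * (real (Suc n) / L1)"
        by (intro mult_left_mono Suc.prems) simp
      finally show ?thesis by (simp del: of_nat_Suc)
    qed
    have nwv: "norm (w - v) \<le> 1 / L1"
    proof -
      have "norm (w - v) = 1 / real (Suc n) * norm w"
        unfolding wv by simp
      also have "\<dots> \<le> 1 / real (Suc n) * (real (Suc n) / L1)"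
        by (intro mult_left_mono Suc.prems) simp
      finally show ?thesis by (simp del: of_nat_Suc)
    qed
    have "1 + (G (x + w) - m) = 1 + (G ((x + v) + (w - v)) - m)"
      by (simp add: algebra_simps)
    also have "\<dots> \<le> c * (1 + (G (x + v) - m))"
      by (rule local[OF nwv])
    also have "\<dots> \<le> c * (c ^ n * (1 + (G x - m)))"
      by (intro mult_left_mono Suc.IH nv c)
    finally show ?case by (simp add: mult_ac)
  qed
  moreover have "R \<le> nat \<lceil>R * L1\<rceil> / L1"
    using pos real_nat_ceiling_ge[of "R * L1"] by (simp add: pos_le_divide_eq)
  ultimately show ?thesis
    using c by (intro exI[of _ "c ^ nat \<lceil>R * L1\<rceil>"]) (meson order_trans zero_le_power)
qed

text \<open>The step sizes need not be small, so a displacement of \<open>q\<close> may leave the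
  radius \<open>1 / L1\<close>. The quadratic bound is extended to any radius, with a coefficient
  proportional to the energy.\<close>

lemma L0L1_smooth_expansion_ball:
  fixes G :: "'a::euclidean_space \<Rightarrow> real"
  assumes G: "L0L1_smooth L0 L1 G" and low: "\<And>x. m \<le> G x"
  shows "\<exists>C\<ge>0. \<forall>x w. norm w \<le> R \<longrightarrow>
    G (x + w) \<le> G x + gradient G x \<bullet> w + C * (1 + (G x - m)) * (norm w)\<^sup>2"
proof -
  have pos: "0 \<le> L0" "0 < L1"
    using G by (auto simp: L0L1_smooth_def)
  obtain C1 where C1: "0 \<le> C1"
    "\<And>x w. norm w \<le> R \<Longrightarrow> 1 + (G (x + w) - m) \<le> C1 * (1 + (G x - m))"
    using L0L1_smooth_growth[OF G low] by blast
  define C2 where "C2 = 4 * L1 + L0 / L1"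
  have C2: "0 \<le> C2"
    using pos by (simp add: C2_def)
  have grad: "norm (gradient G x) \<le> C2 * (1 + (G x - m))" for x
    unfolding C2_def by (rule L0L1_smooth_gradient_le_energy[OF G low])
  \<comment> \<open>The cost of displacements longer than \<open>1 / L1\<close>. The absolute value
    keeps the constant nonnegative for negative \<open>R\<close>, where the claim is
    vacuous.\<close>
  define C3 where "C3 = (C1 + C2 * \<bar>R\<bar>) * L1\<^sup>2"
  define C where "C = L0 + L1 * C2 + C3"
  have C3: "0 \<le> C3" and C: "0 \<le> C"
    using pos C1(1) C2 by (simp_all add: C_def C3_def)
  have "G (x + w) \<le> G x + gradient G x \<bullet> w + C * (1 + (G x - m)) * (norm w)\<^sup>2"
    if w: "norm w \<le> R" for x w
  proof -
    define W where "W = 1 + (G x - m)"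
    have W: "1 \<le> W"
      using low[of x] by (simp add: W_def)
    show ?thesis
    proof (cases "norm w \<le> 1 / L1")
      case True
      have "L0 * 1 + L1 * norm (gradient G x) \<le> L0 * W + L1 * (C2 * W)"
        using pos W grad[of x] by (intro add_mono mult_left_mono) (auto simp: W_def)
      also have "\<dots> \<le> C * W"
        using C3 W by (simp add: C_def algebra_simps)
      finally have "(L0 + L1 * norm (gradient G x)) * (norm w)\<^sup>2 \<le> C * W * (norm w)\<^sup>2"
        by (intro mult_right_mono) auto
      then show ?thesis
        using L0L1_smooth_expansion[OF G True, of x] by (simp add: W_def)
    next
      case False
      \<comment> \<open>Here \<open>1 \<le> (L1 * norm w)\<^sup>2\<close>, so any bound on \<open>G (x + w)\<close> can be charged to the quadratic term.\<close>
      have "- (gradient G x \<bullet> w) \<le> norm (gradient G x) * norm w"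
        using norm_cauchy_schwarz[of "gradient G x" "- w"] by simp
      also have "\<dots> \<le> (C2 * W) * \<bar>R\<bar>"
        using grad[of x] w C2 W by (intro mult_mono) (auto simp: W_def)
      finally have "G (x + w) - G x - gradient G x \<bullet> w \<le> (C1 + C2 * \<bar>R\<bar>) * W"
        using C1(2)[OF w, of x] low[of x] by (simp add: W_def algebra_simps)
      also have "\<dots> \<le> (C1 + C2 * \<bar>R\<bar>) * W * (L1 * norm w)\<^sup>2"
      proof -
        have "1 \<le> L1 * norm w"
          using False pos by (simp add: field_simps)
        then have "1 \<le> (L1 * norm w)\<^sup>2"
          by (simp add: one_le_power)
        then show ?thesis
          using mult_left_mono[of 1 "(L1 * norm w)\<^sup>2" "(C1 + C2 * \<bar>R\<bar>) * W"] C1(1) C2 W by simp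
      qed
      also have "\<dots> = C3 * (W * (norm w)\<^sup>2)"
        by (simp add: C3_def power_mult_distrib)
      also have "\<dots> \<le> C * (W * (norm w)\<^sup>2)"
        using pos C2 W by (intro mult_right_mono) (auto simp: C_def)
      finally show ?thesis
        by (simp add: W_def)
    qed
  qed
  then show ?thesis
    by (intro exI[of _ C] conjI C allI impI)
qed

section \<open>Change of the energy in one step\<close>

text \<open>Convexity at \<open>p'\<close> and the expansion of \<open>F\<close> both involve the
  gradient \<open>v\<close> of \<phi> at the new momentum, which depends on \<open>g\<close> and so
  is not decoupled from the noise. Replacing \<open>v\<close> by the gradient \<open>P\<close> at
  the old momentum costs a Lipschitz error of order \<open>a\<^sup>2\<close> and leaves a
  first-order term linear in \<open>n\<close>. The free remainder \<open>r\<close> lets both kinds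
  of smoothness use the estimate.\<close>

lemma energy_step:
  fixes F \<phi> :: "'a::euclidean_space \<Rightarrow> real" and p q g n :: 'a
  assumes convex: "\<And>x y. \<phi> y - \<phi> x \<le> gradient \<phi> y \<bullet> (y - x)"
    and lip: "\<And>x y. norm (gradient \<phi> y - gradient \<phi> x) \<le> lam * norm (x - y)"
    and a: "0 \<le> a" and \<gamma>: "0 \<le> \<gamma>" and lam: "0 \<le> lam"
    and p': "p' = p - a *\<^sub>R g - (a * \<gamma>) *\<^sub>R gradient \<phi> p"
    and q': "q' = q + a *\<^sub>R gradient \<phi> p'"
    and expansion: "F q' \<le> F q + gradient F q \<bullet> (a *\<^sub>R gradient \<phi> p') + a\<^sup>2 * r"
    and n: "n = gradient F q - g"
  shows "F q' + \<phi> p' \<le> F q + \<phi> p + a * (gradient \<phi> p \<bullet> n)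
    + a\<^sup>2 * (lam * norm (g + \<gamma> *\<^sub>R gradient \<phi> p) * (norm n + \<gamma> * norm (gradient \<phi> p)) + r)"
proof -
  define P where "P = gradient \<phi> p"
  define v where "v = gradient \<phi> p'"
  define h where "h = g + \<gamma> *\<^sub>R P"
  have step: "p' - p = - (a *\<^sub>R h)"
    by (simp add: p' h_def P_def algebra_simps)
  have "norm (v - P) \<le> lam * norm (p - p')"
    unfolding v_def P_def by (rule lip)
  also have "norm (p - p') = a * norm h"
    using step a by (metis abs_of_nonneg norm_minus_cancel norm_minus_commute norm_scaleR)
  finally have vP: "norm (v - P) \<le> lam * (a * norm h)" .
  have "norm (n - \<gamma> *\<^sub>R P) \<le> norm n + \<gamma> * norm P"
    using norm_triangle_ineq4[of n "\<gamma> *\<^sub>R P"] \<gamma> by simp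
  then have "(v - P) \<bullet> (n - \<gamma> *\<^sub>R P) \<le> lam * (a * norm h) * (norm n + \<gamma> * norm P)"
    using vP \<gamma> lam a
    by (intro order_trans[OF norm_cauchy_schwarz] mult_mono) auto
  then have drift: "a * ((v - P) \<bullet> (n - \<gamma> *\<^sub>R P)) \<le> a\<^sup>2 * (lam * norm h * (norm n + \<gamma> * norm P))"
    using mult_left_mono[OF _ a] by (fastforce simp: power2_eq_square mult_ac)
  have damping: "0 \<le> a * \<gamma> * (P \<bullet> P)"
    using a \<gamma> by simp
  have "\<phi> p' \<le> \<phi> p + v \<bullet> (- (a *\<^sub>R h))"
    using convex[of p' p] unfolding step v_def by simp
  then have "F q' + \<phi> p' \<le> F q + \<phi> p + (gradient F q \<bullet> (a *\<^sub>R v) + v \<bullet> (- (a *\<^sub>R h))) + a\<^sup>2 * r"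
    using expansion by (simp add: v_def)
  \<comment> \<open>Here \<open>gradient F q - h = n - \<gamma> *\<^sub>R P\<close>, and
    \<open>v\<close> is split as \<open>P + (v - P)\<close>.\<close>
  also have "gradient F q \<bullet> (a *\<^sub>R v) + v \<bullet> (- (a *\<^sub>R h))
      = a * (P \<bullet> n) - a * \<gamma> * (P \<bullet> P) + a * ((v - P) \<bullet> (n - \<gamma> *\<^sub>R P))"
    by (simp add: h_def n inner_commute algebra_simps inner_diff_left inner_diff_right inner_add_left inner_add_right)
  finally show ?thesis
    using drift damping unfolding P_def[symmetric] h_def[symmetric] distrib_left[of "a\<^sup>2"]
    by linarith
qed

text \<open>Every vector in the remainder is bounded by a multiple of \<open>s\<close>, the sum of
  the noise and both gradient norms. The squares of the gradients are bounded by the two parts of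
  the energy, so only the squared noise is left over.\<close>

lemma energy_step_lipschitz:
  fixes F \<phi> :: "'a::euclidean_space \<Rightarrow> real"
  assumes F_diff: "\<And>x. F differentiable (at x)" and \<phi>_diff: "\<And>x. \<phi> differentiable (at x)"
    and convex: "\<And>x y. \<phi> y - \<phi> x \<le> gradient \<phi> y \<bullet> (y - x)"
    and \<phi>_lip: "\<And>x y. norm (gradient \<phi> y - gradient \<phi> x) \<le> lam * norm (x - y)" and lam: "0 < lam"
    and F_lip: "\<And>x y. norm (gradient F y - gradient F x) \<le> L * norm (x - y)" and L: "0 < L"
    and F_low: "\<And>x. F_low \<le> F x" and \<phi>_low: "\<And>x. \<phi>_low \<le> \<phi> x"
    and \<gamma>: "0 \<le> \<gamma>"
  obtains C where "0 \<le> C" and "\<And>a p q g p'. 0 \<le> a \<Longrightarrow> a \<le> A \<Longrightarrow>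
    p' = p - a *\<^sub>R g - (a * \<gamma>) *\<^sub>R gradient \<phi> p \<Longrightarrow>
    F (q + a *\<^sub>R gradient \<phi> p') + \<phi> p' \<le> F q + \<phi> p + a * (gradient \<phi> p \<bullet> (gradient F q - g))
      + a\<^sup>2 * (C * (1 + (F q - F_low) + (\<phi> p - \<phi>_low) + (norm (gradient F q - g))\<^sup>2))"
proof -
  \<comment> \<open>The coefficient of \<open>s\<^sup>2\<close>: one factor
    \<open>1 + \<gamma>\<close> each from \<open>h\<close> and from noise plus damping, and in the
    second summand the bound on \<open>v\<close>, whose distance to the gradient at \<open>p\<close>
    is at most \<open>lam * (a * norm h)\<close>.\<close>
  define B where "B = lam * (1 + \<gamma>)\<^sup>2 + L * (1 + lam * \<bar>A\<bar> * (1 + \<gamma>))\<^sup>2"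
  \<comment> \<open>The 3 comes from squaring a sum of three terms, the rest from the bounds on the
    squared gradients of \<open>F\<close> and \<phi>.\<close>
  define C where "C = B * (3 * (1 + 4 * L + 4 * lam))"
  have B: "0 \<le> B" and C: "0 \<le> C"
    using lam L by (simp_all add: B_def C_def)
  have "F (q + a *\<^sub>R gradient \<phi> p') + \<phi> p' \<le> F q + \<phi> p + a * (gradient \<phi> p \<bullet> (gradient F q - g))
      + a\<^sup>2 * (C * (1 + (F q - F_low) + (\<phi> p - \<phi>_low) + (norm (gradient F q - g))\<^sup>2))"
    if a: "0 \<le> a" "a \<le> A" and p': "p' = p - a *\<^sub>R g - (a * \<gamma>) *\<^sub>R gradient \<phi> p" for a p q g p'
  proof -
    define n where "n = gradient F q - g"
    define h where "h = g + \<gamma> *\<^sub>R gradient \<phi> p"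
    define v where "v = gradient \<phi> p'"
    define s where "s = norm n + norm (gradient F q) + norm (gradient \<phi> p)"
    define u where "u = F q - F_low"
    define w where "w = \<phi> p - \<phi>_low"
    have u: "0 \<le> u" and w: "0 \<le> w"
      using F_low[of q] \<phi>_low[of p] by (auto simp: u_def w_def)
    have s: "0 \<le> s"
      by (simp add: s_def)
    have "h = gradient F q - n + \<gamma> *\<^sub>R gradient \<phi> p"
      by (simp add: h_def n_def)
    then have "norm h \<le> norm (gradient F q) + norm n + \<gamma> * norm (gradient \<phi> p)"
      using norm_triangle_ineq[of "gradient F q - n" "\<gamma> *\<^sub>R gradient \<phi> p"]
        norm_triangle_ineq4[of "gradient F q" n] \<gamma> by simp
    also have "\<dots> \<le> s + \<gamma> * s"
      using \<gamma> by (intro add_mono mult_left_mono) (auto simp: s_def)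
    finally have h: "norm h \<le> (1 + \<gamma>) * s"
      by (simp add: algebra_simps)
    have noise: "norm n + \<gamma> * norm (gradient \<phi> p) \<le> (1 + \<gamma>) * s"
      using mult_left_mono[of "norm (gradient \<phi> p)" s \<gamma>] \<gamma>
      by (simp add: s_def algebra_simps)
    have step: "p - p' = a *\<^sub>R h"
      by (simp add: p' h_def algebra_simps)
    have "norm v \<le> norm (gradient \<phi> p) + lam * norm (p - p')"
      unfolding v_def using \<phi>_lip[of p' p] norm_triangle_sub[of "gradient \<phi> p'" "gradient \<phi> p"] by simp
    also have "norm (p - p') = a * norm h"
      using a by (simp add: step)
    also have "lam * (a * norm h) \<le> lam * (\<bar>A\<bar> * ((1 + \<gamma>) * s))"
      using a h lam by (intro mult_left_mono mult_mono) auto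
    also have "norm (gradient \<phi> p) \<le> s"
      by (simp add: s_def)
    finally have v: "norm v \<le> (1 + lam * \<bar>A\<bar> * (1 + \<gamma>)) * s"
      by (simp add: algebra_simps)
    have "F (q + a *\<^sub>R v) \<le> F q + gradient F q \<bullet> (a *\<^sub>R v) + a\<^sup>2 * (L * (norm v)\<^sup>2)"
      using lipschitz_gradient_expansion[OF F_diff _ F_lip, of q "a *\<^sub>R v"] L a
      by (simp add: power_mult_distrib mult_ac)
    then have step_bound: "F (q + a *\<^sub>R v) + \<phi> p' \<le> F q + \<phi> p + a * (gradient \<phi> p \<bullet> n)
        + a\<^sup>2 * (lam * norm h * (norm n + \<gamma> * norm (gradient \<phi> p)) + L * (norm v)\<^sup>2)"
      unfolding h_def v_def using lam a \<gamma>
      by (intro energy_step[OF convex \<phi>_lip _ _ _ p' refl _ n_def]) auto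
    have "lam * norm h * (norm n + \<gamma> * norm (gradient \<phi> p)) + L * (norm v)\<^sup>2 \<le> B * s\<^sup>2"
    proof -
      have "lam * norm h * (norm n + \<gamma> * norm (gradient \<phi> p))
          \<le> lam * ((1 + \<gamma>) * s) * ((1 + \<gamma>) * s)"
        using lam \<gamma> h noise s by (intro mult_mono mult_left_mono) auto
      moreover have "L * (norm v)\<^sup>2 \<le> L * ((1 + lam * \<bar>A\<bar> * (1 + \<gamma>)) * s)\<^sup>2"
        using L v by (intro mult_left_mono power_mono) auto
      ultimately show ?thesis
        by (simp add: B_def power_mult_distrib power2_eq_square algebra_simps)
    qed
    also have "B * s\<^sup>2 \<le> B * ((3 * (1 + 4 * L + 4 * lam)) * (1 + u + w + (norm n)\<^sup>2))"
    proof (intro mult_left_mono B)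
      have sq: "(x + y + z)\<^sup>2 \<le> 3 * (x\<^sup>2 + y\<^sup>2 + z\<^sup>2)" for x y z :: real
        using zero_le_power2[of "x - y"] zero_le_power2[of "y - z"] zero_le_power2[of "x - z"]
        by (simp add: power2_eq_square algebra_simps)
      have "s\<^sup>2 \<le> 3 * ((norm n)\<^sup>2 + (norm (gradient F q))\<^sup>2 + (norm (gradient \<phi> p))\<^sup>2)"
        unfolding s_def by (rule sq)
      also have "\<dots> \<le> 3 * ((norm n)\<^sup>2 + 4 * L * u + 4 * lam * w)"
        unfolding u_def w_def
        using lipschitz_gradient_bound[OF F_diff L F_lip F_low, of q]
          lipschitz_gradient_bound[OF \<phi>_diff lam \<phi>_lip \<phi>_low, of p] by simp
      also have "\<dots> \<le> 3 * ((1 + 4 * L + 4 * lam) * (1 + u + w + (norm n)\<^sup>2))"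
      proof -
        define m where "m = 1 + 4 * L + 4 * lam"
        have "1 * (norm n)\<^sup>2 + 4 * L * u + 4 * lam * w \<le> m * (norm n)\<^sup>2 + m * u + m * w"
          using L lam u w by (intro add_mono mult_right_mono) (auto simp: m_def)
        moreover have "0 \<le> m"
          using L lam by (simp add: m_def)
        ultimately show ?thesis
          unfolding m_def[symmetric] by (simp add: distrib_left)
      qed
      finally show "s\<^sup>2 \<le> 3 * (1 + 4 * L + 4 * lam) * (1 + u + w + (norm n)\<^sup>2)"
        by (simp only: mult.assoc)
    qed
    also have "\<dots> = C * (1 + u + w + (norm n)\<^sup>2)"
      by (simp only: C_def mult.assoc)
    finally show ?thesis
      unfolding v_def[symmetric] n_def[symmetric] u_def[symmetric] w_def[symmetric]
      using step_bound by (meson add_left_mono mult_left_mono order_trans zero_le_power2)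
  qed
  then show thesis
    by (rule that[OF C])
qed

text \<open>The gradient of \<open>F\<close> is now only linear in the energy, so its square must be
  avoided. The bound \<Delta> does this: the damping is bounded, hence a factor
  \<open>norm g\<close> occurs either times the noise or times a constant. It also confines the
  displacement of \<open>q\<close> to radius \<open>A * \<Delta>\<close>.\<close>

lemma energy_step_L0L1:
  fixes F \<phi> :: "'a::euclidean_space \<Rightarrow> real"
  assumes convex: "\<And>x y. \<phi> y - \<phi> x \<le> gradient \<phi> y \<bullet> (y - x)"
    and \<phi>_lip: "\<And>x y. norm (gradient \<phi> y - gradient \<phi> x) \<le> lam * norm (x - y)" and lam: "0 < lam"
    and \<phi>_grad: "\<And>x. norm (gradient \<phi> x) \<le> \<Delta>"
    and F_smooth: "L0L1_smooth L0 L1 F"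
    and F_low: "\<And>x. F_low \<le> F x"
    and \<gamma>: "0 \<le> \<gamma>"
  obtains C where "0 \<le> C" and "\<And>a p q g p'. 0 \<le> a \<Longrightarrow> a \<le> A \<Longrightarrow>
    p' = p - a *\<^sub>R g - (a * \<gamma>) *\<^sub>R gradient \<phi> p \<Longrightarrow>
    F (q + a *\<^sub>R gradient \<phi> p') + \<phi> p' \<le> F q + \<phi> p + a * (gradient \<phi> p \<bullet> (gradient F q - g))
      + a\<^sup>2 * (C * (1 + (F q - F_low) + norm (gradient F q - g) * (1 + norm g)))"
proof -
  have pos: "0 \<le> L0" "0 < L1"
    using F_smooth by (auto simp: L0L1_smooth_def)
  have \<Delta>: "0 \<le> \<Delta>"
    using \<phi>_grad[of 0] norm_ge_zero order_trans by blast
  obtain K where K: "0 \<le> K" "\<And>x w. norm w \<le> A * \<Delta> \<Longrightarrow>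
      F (x + w) \<le> F x + gradient F x \<bullet> w + K * (1 + (F x - F_low)) * (norm w)\<^sup>2"
    using L0L1_smooth_expansion_ball[OF F_smooth F_low] by metis
  define c where "c = 1 + \<gamma> * \<Delta>"
  define d where "d = 4 * L1 + L0 / L1"
  \<comment> \<open>The first summand collects the momentum error, with \<open>c - 1\<close>
    bounding the damping and \<open>d\<close> the gradient of \<open>F\<close> relative to
    \<open>W\<close>; the second is the expansion of \<open>F\<close> on the ball.\<close>
  define C where "C = lam * (2 * c + c * (d + c)) + K * \<Delta>\<^sup>2"
  have c: "1 \<le> c" and d: "0 \<le> d"
    using \<gamma> \<Delta> pos by (simp_all add: c_def d_def)
  have C: "0 \<le> C"
    using lam c d K(1) by (simp add: C_def)
  have "F (q + a *\<^sub>R gradient \<phi> p') + \<phi> p' \<le> F q + \<phi> p + a * (gradient \<phi> p \<bullet> (gradient F q - g))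
      + a\<^sup>2 * (C * (1 + (F q - F_low) + norm (gradient F q - g) * (1 + norm g)))"
    if a: "0 \<le> a" "a \<le> A" and p': "p' = p - a *\<^sub>R g - (a * \<gamma>) *\<^sub>R gradient \<phi> p" for a p q g p'
  proof -
    define n where "n = gradient F q - g"
    define h where "h = g + \<gamma> *\<^sub>R gradient \<phi> p"
    define v where "v = gradient \<phi> p'"
    define W where "W = 1 + (F q - F_low)"
    define N where "N = norm n * (1 + norm g)"
    have W: "1 \<le> W"
      using F_low[of q] by (simp add: W_def)
    have N: "0 \<le> N"
      by (simp add: N_def)
    have grad: "norm (gradient F q) \<le> d * W"
      unfolding d_def W_def by (rule L0L1_smooth_gradient_le_energy[OF F_smooth F_low])
    have "\<gamma> * norm (gradient \<phi> p) \<le> \<gamma> * \<Delta>"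
      by (rule mult_left_mono[OF \<phi>_grad \<gamma>])
    then have P: "\<gamma> * norm (gradient \<phi> p) \<le> c - 1"
      by (simp add: c_def)
    have h: "norm h \<le> norm g + (c - 1)"
      unfolding h_def using P norm_triangle_ineq[of g "\<gamma> *\<^sub>R gradient \<phi> p"] \<gamma> by simp
    have av: "norm (a *\<^sub>R v) \<le> A * \<Delta>"
      using a \<phi>_grad[of p'] by (simp add: v_def mult_mono)
    have "K * W * (norm (a *\<^sub>R v))\<^sup>2 = a\<^sup>2 * (K * W * (norm v)\<^sup>2)"
      using a by (simp add: power_mult_distrib)
    also have "\<dots> \<le> a\<^sup>2 * (K * W * \<Delta>\<^sup>2)"
      using K(1) W \<phi>_grad[of p'] by (intro mult_left_mono power_mono) (auto simp: v_def)
    finally have "F (q + a *\<^sub>R v) \<le> F q + gradient F q \<bullet> (a *\<^sub>R v) + a\<^sup>2 * (K * W * \<Delta>\<^sup>2)"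
      using K(2)[OF av, of q] by (simp add: W_def)
    then have step_bound: "F (q + a *\<^sub>R v) + \<phi> p' \<le> F q + \<phi> p + a * (gradient \<phi> p \<bullet> n)
        + a\<^sup>2 * (lam * norm h * (norm n + \<gamma> * norm (gradient \<phi> p)) + K * W * \<Delta>\<^sup>2)"
      unfolding h_def v_def using lam a \<gamma>
      by (intro energy_step[OF convex \<phi>_lip _ _ _ p' refl _ n_def]) auto
    have error: "lam * norm h * (norm n + \<gamma> * norm (gradient \<phi> p)) + K * W * \<Delta>\<^sup>2 \<le> C * (W + N)"
    proof -
      have g_le: "norm g \<le> norm n + d * W"
        using grad norm_triangle_ineq4[of "gradient F q" n] by (simp add: n_def)
      have "norm h * (norm n + \<gamma> * norm (gradient \<phi> p)) \<le> (norm g + (c - 1)) * (norm n + (c - 1))"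
        using h P c \<gamma> by (intro mult_mono) auto
      also have "\<dots> = norm n * (norm g + (c - 1)) + (c - 1) * (norm g + (c - 1))"
        by (simp add: algebra_simps)
      also have "\<dots> \<le> norm n * (c * (1 + norm g)) + c * (norm n * (1 + norm g) + (d + c) * W)"
      proof (rule add_mono)
        have "norm g * 1 \<le> norm g * c"
          using c by (intro mult_left_mono) auto
        then have "norm g + (c - 1) \<le> c * (1 + norm g)"
          by (simp add: algebra_simps)
        then show "norm n * (norm g + (c - 1)) \<le> norm n * (c * (1 + norm g))"
          by (rule mult_left_mono) simp
        \<comment> \<open>Without a noise factor in front, \<open>norm g\<close> is replaced by
          \<open>norm n + d * W\<close>, which keeps the term linear in the energy.\<close>
        have "norm n * 1 \<le> norm n * (1 + norm g)" "c * 1 \<le> c * W"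
          using c W by (intro mult_left_mono; simp)+
        then have "norm g + (c - 1) \<le> norm n * (1 + norm g) + (d + c) * W"
          using g_le unfolding distrib_right by linarith
        then show "(c - 1) * (norm g + (c - 1)) \<le> c * (norm n * (1 + norm g) + (d + c) * W)"
          using c by (intro mult_mono) auto
      qed
      also have "\<dots> = 2 * c * N + c * (d + c) * W"
        by (simp add: N_def algebra_simps)
      also have "\<dots> \<le> (2 * c + c * (d + c)) * (W + N)"
        using c d W N by (simp add: algebra_simps)
      finally have "lam * (norm h * (norm n + \<gamma> * norm (gradient \<phi> p)))
          \<le> lam * ((2 * c + c * (d + c)) * (W + N))"
        using lam by (intro mult_left_mono) auto
      moreover have "K * W * \<Delta>\<^sup>2 \<le> K * \<Delta>\<^sup>2 * (W + N)"
        using K(1) N by (simp add: algebra_simps)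
      ultimately show ?thesis
        by (simp add: C_def algebra_simps)
    qed
    then show ?thesis
      unfolding v_def[symmetric] n_def[symmetric] W_def[symmetric] N_def[symmetric]
      using step_bound by (meson add_left_mono mult_left_mono order_trans zero_le_power2)
  qed
  then show thesis
    by (rule that[OF C])
qed

section \<open>Mean energy after one step and moments of the stochastic gradient\<close>

lemma (in prob_space) nn_integral_energy_growth:
  fixes G :: "'a \<Rightarrow> 'b::euclidean_space"
  assumes G: "integrable M G" "expectation G = D"
    and E: "integrable M E" "expectation E \<le> C' * v"
    and nonneg: "0 \<le> C" "\<And>\<omega>. \<omega> \<in> space M \<Longrightarrow> 0 \<le> V \<omega>"
    and step: "\<And>\<omega>. \<omega> \<in> space M \<Longrightarrow> V \<omega> \<le> v + a * (u \<bullet> (D - G \<omega>)) + a\<^sup>2 * (C * (v + E \<omega>))"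
    and v: "0 \<le> v" and C': "0 \<le> C'"
  shows "(\<integral>\<^sup>+\<omega>. ennreal (V \<omega>) \<partial>M) \<le> ennreal (1 + C * (1 + C') * a\<^sup>2) * ennreal v"
proof -
  \<comment> \<open>An integrable majorant of \<open>V\<close>. Its first-order term has mean zero
    because \<open>D\<close> is the mean of \<open>G\<close>, and it inherits nonnegativity from
    \<open>V\<close>, so its \<open>ennreal\<close> integral equals its expectation.\<close>
  define h where "h = (\<lambda>\<omega>. v + a * (u \<bullet> (D - G \<omega>)) + a\<^sup>2 * (C * (v + E \<omega>)))"
  have Vh: "V \<omega> \<le> h \<omega>" "0 \<le> h \<omega>" if "\<omega> \<in> space M" for \<omega>
    using step[OF that] nonneg(2)[OF that] by (auto simp: h_def)
  have h: "integrable M h"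
    unfolding h_def using G E by auto
  have "expectation h = v + a\<^sup>2 * (C * (v + expectation E))"
    unfolding h_def using G E by (simp add: prob_space)
  also have "\<dots> \<le> v + a\<^sup>2 * (C * (v + C' * v))"
    using E nonneg by (intro add_left_mono mult_left_mono) auto
  also have "\<dots> = (1 + C * (1 + C') * a\<^sup>2) * v"
    by (simp add: algebra_simps)
  finally have bound: "expectation h \<le> (1 + C * (1 + C') * a\<^sup>2) * v" .
  have "(\<integral>\<^sup>+\<omega>. ennreal (V \<omega>) \<partial>M) \<le> ennreal (expectation h)"
    using Vh by (subst nn_integral_eq_integral[OF h, symmetric])
      (auto intro!: nn_integral_mono ennreal_leI AE_I2)
  also have "\<dots> \<le> ennreal ((1 + C * (1 + C') * a\<^sup>2) * v)"
    by (rule ennreal_leI[OF bound])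
  also have "\<dots> = ennreal (1 + C * (1 + C') * a\<^sup>2) * ennreal v"
    by (rule ennreal_mult''[OF v])
  finally show ?thesis .
qed

text \<open>On expanding the square, unbiasedness turns the cross term into minus twice the squared
  gradient norm; what remains is the difference of moments that defines
  \<open>grad_variance\<close>.\<close>

lemma (in prob_space) centered_gradient_second_moment:
  assumes "finite_second_moment M X g x" and g: "integrable M (\<lambda>\<omega>. g x (X \<omega>))"
    and mean: "(\<integral>\<omega>. g x (X \<omega>) \<partial>M) = gradient F x"
  shows "integrable M (\<lambda>\<omega>. (norm (gradient F x - g x (X \<omega>)))\<^sup>2)"
    and "(\<integral>\<omega>. (norm (gradient F x - g x (X \<omega>)))\<^sup>2 \<partial>M) = grad_variance M X g F x"
proof -
  define D where "D = gradient F x"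
  have expand: "(norm (D - g x (X \<omega>)))\<^sup>2 = D \<bullet> D - 2 * (D \<bullet> g x (X \<omega>)) + (norm (g x (X \<omega>)))\<^sup>2" for \<omega>
    by (simp add: power2_norm_eq_inner inner_diff_left inner_diff_right inner_commute)
  have sq: "integrable M (\<lambda>\<omega>. (norm (g x (X \<omega>)))\<^sup>2)"
    using assms(1) by (simp add: finite_second_moment_def)
  show "integrable M (\<lambda>\<omega>. (norm (gradient F x - g x (X \<omega>)))\<^sup>2)"
    unfolding D_def[symmetric] expand using sq g by auto
  show "(\<integral>\<omega>. (norm (gradient F x - g x (X \<omega>)))\<^sup>2 \<partial>M) = grad_variance M X g F x"
    unfolding D_def[symmetric] expand grad_variance_def
    using sq g mean by (simp add: prob_space D_def power2_norm_eq_inner)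
qed

text \<open>The batch mean is itself smooth, so its gradient is bounded by its own excess over a
  lower bound. All summands \<open>f i x - m i\<close> are nonnegative, so enlarging
  \<open>B\<close> to \<open>I\<close> makes the bound independent of the batch.\<close>

lemma minibatch_gradient_bound:
  fixes f :: "nat \<Rightarrow> 'a::euclidean_space \<Rightarrow> real"
  assumes f: "\<And>i x. i \<in> I \<Longrightarrow> f i differentiable (at x)" "\<And>i x. i \<in> I \<Longrightarrow> m i \<le> f i x"
    and I: "finite I" and B: "B \<subseteq> I" "B \<noteq> {}"
    and smooth: "L0L1_smooth L0 L1 (\<lambda>x. (1 / real (card B)) * (\<Sum>i\<in>B. f i x))"
  shows "norm ((1 / real (card B)) *\<^sub>R (\<Sum>i\<in>B. gradient (f i) x))
    \<le> 4 * L1 * (\<Sum>i\<in>I. f i x - m i) + L0 / L1"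
proof -
  let ?f = "\<lambda>x. (1 / real (card B)) * (\<Sum>i\<in>B. f i x)"
  have pos: "0 < L1"
    using smooth by (simp add: L0L1_smooth_def)
  have fin: "finite B"
    using I B finite_subset by blast
  then have card: "1 \<le> real (card B)"
    using B by (simp add: Suc_le_eq card_gt_0_iff)
  have "(f i has_derivative (\<lambda>h. h \<bullet> gradient (f i) x)) (at x)" if "i \<in> B" for i
    using gradient_works[OF f(1)] that B by (auto simp: gderiv_def)
  then have "(?f has_derivative (\<lambda>h. (1 / real (card B)) * (\<Sum>i\<in>B. h \<bullet> gradient (f i) x))) (at x)"
    by (intro has_derivative_mult_right has_derivative_sum)
  then have "GDERIV ?f x :> (1 / real (card B)) *\<^sub>R (\<Sum>i\<in>B. gradient (f i) x)"
    by (simp add: gderiv_def inner_sum_right)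
  then have grad: "gradient ?f x = (1 / real (card B)) *\<^sub>R (\<Sum>i\<in>B. gradient (f i) x)"
    by (rule gradient_eqI)
  have low: "(1 / real (card B)) * (\<Sum>i\<in>B. m i) \<le> ?f y" for y
    using B f(2) by (intro mult_left_mono sum_mono) auto
  have "?f x - (1 / real (card B)) * (\<Sum>i\<in>B. m i) = (1 / real (card B)) * (\<Sum>i\<in>B. f i x - m i)"
    by (simp add: sum_subtractf diff_divide_distrib)
  also have "\<dots> \<le> 1 * (\<Sum>i\<in>B. f i x - m i)"
    using card B f(2) by (intro mult_right_mono sum_nonneg) auto
  also have "\<dots> \<le> (\<Sum>i\<in>I. f i x - m i)"
    using I B f(2) by (simp, intro sum_mono2) auto
  finally have "4 * L1 * (?f x - (1 / real (card B)) * (\<Sum>i\<in>B. m i)) \<le> 4 * L1 * (\<Sum>i\<in>I. f i x - m i)"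
    using pos by (intro mult_left_mono) auto
  with L0L1_smooth_gradient_bound[OF smooth low, of x] show ?thesis
    unfolding grad by linarith
qed

lemma coercive_sublevel_bounded:
  fixes G :: "'a::real_normed_vector \<Rightarrow> real"
  assumes "filterlim G at_top at_infinity"
  obtains b where "\<And>x. G x \<le> c \<Longrightarrow> norm x \<le> b"
proof -
  have "eventually (\<lambda>x. c + 1 \<le> G x) at_infinity"
    using assms by (auto simp: filterlim_at_top)
  then obtain b where "\<And>x. b \<le> norm x \<Longrightarrow> c + 1 \<le> G x"
    by (auto simp: eventually_at_infinity)
  then show thesis
    by (intro that[of b]) (meson add_le_same_cancel1 not_one_le_zero linear order_trans)
qed

section \<open>Boundedness of the iterates\<close>

text \<open>Integrability of \<open>F (q k \<omega>)\<close> stands beside the bound on the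
  expectations because the Bochner integral of a non-integrable function is 0, which would make the
  bound empty.\<close>

theorem theorem8:
  fixes M :: "'w measure" and S :: "'e measure"
    and \<xi> :: "nat \<Rightarrow> 'w \<Rightarrow> 'e" and X :: "'w \<Rightarrow> 'e"
    and F \<phi> :: "real ^ 'n \<Rightarrow> real"
    and g :: "real ^ 'n \<Rightarrow> 'e \<Rightarrow> real ^ 'n"
    and p q :: "nat \<Rightarrow> 'w \<Rightarrow> real ^ 'n" and q0 :: "real ^ 'n"
    and \<alpha> :: "nat \<Rightarrow> real" and \<gamma> lam F_low \<phi>_low :: real
  assumes "prob_space M"
    and indep: "prob_space.indep_vars M (\<lambda>_. S) \<xi> UNIV"
    and generic: "X \<in> M \<rightarrow>\<^sub>M S"
    and same_distr: "\<And>k. distr M S (\<xi> k) = distr M S X"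
    and F_diff: "\<And>x. F differentiable (at x)"
    and \<phi>_diff: "\<And>x. \<phi> differentiable (at x)"
    and \<gamma>_pos: "\<gamma> > 0"
    and g_meas: "(\<lambda>(x, e). g x e) \<in> borel \<Otimes>\<^sub>M S \<rightarrow>\<^sub>M borel"
    and p_init: "\<And>\<omega>. \<omega> \<in> space M \<Longrightarrow> p 0 \<omega> = 0"
    and q_init: "\<And>\<omega>. \<omega> \<in> space M \<Longrightarrow> q 0 \<omega> = q0"
    and p_step: "\<And>k \<omega>. \<omega> \<in> space M \<Longrightarrow>
      p (Suc k) \<omega> = p k \<omega> - \<alpha> k *\<^sub>R g (q k \<omega>) (\<xi> k \<omega>) - (\<alpha> k * \<gamma>) *\<^sub>R gradient \<phi> (p k \<omega>)"
    and q_step: "\<And>k \<omega>. \<omega> \<in> space M \<Longrightarrow>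
      q (Suc k) \<omega> = q k \<omega> + \<alpha> k *\<^sub>R gradient \<phi> (p (Suc k) \<omega>)"
    and F_coercive: "filterlim F at_top at_infinity"
    and F_bounded: "\<And>x. F x \<ge> F_low"
    and crit_values: "\<And>K. compact K \<Longrightarrow> finite (F ` {x. gradient F x = 0} \<inter> K)"
    and g_integrable: "\<And>x. integrable M (\<lambda>\<omega>. g x (X \<omega>))"
    and g_unbiased: "\<And>x. (\<integral>\<omega>. g x (X \<omega>) \<partial>M) = gradient F x"
    and lam_pos: "lam > 0"
    and \<phi>_smooth: "\<And>x y. norm (gradient \<phi> y - gradient \<phi> x) \<le> lam * norm (x - y)"
    and \<phi>_convex: "\<And>x y. \<phi> y - \<phi> x \<le> gradient \<phi> y \<bullet> (y - x)"
    and \<phi>_coercive: "filterlim \<phi> at_top at_infinity"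
    and \<phi>_bounded: "\<And>x. \<phi> x \<ge> \<phi>_low"
    and \<alpha>_0: "\<alpha> 0 = 0"
    and \<alpha>_pos: "\<And>k. k \<ge> 1 \<Longrightarrow> \<alpha> k > 0"
    and \<alpha>_sum: "filterlim (\<lambda>n. \<Sum>k<n. \<alpha> k) at_top sequentially"
    and \<alpha>_sq_sum: "summable (\<lambda>k. (\<alpha> k)\<^sup>2)"
    and settings:
      "(\<exists>L \<kappa> \<tau> \<sigma>. L > 0 \<and> \<kappa> \<ge> 0 \<and> \<tau> \<ge> 0 \<and> \<sigma> \<ge> 0 \<and>
          (\<forall>x y. norm (gradient F y - gradient F x) \<le> L * norm (x - y)) \<and>
          (\<forall>x. finite_second_moment M X g x \<and>
            grad_variance M X g F x \<le> \<kappa> * (F x - F_low) + \<tau> * (norm (gradient F x))\<^sup>2 + \<sigma>\<^sup>2))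
       \<or>
       (\<exists>L0 L1 \<sigma> \<Delta>. L0L1_smooth L0 L1 F \<and>
          (\<forall>x. finite_second_moment M X g x \<and> grad_variance M X g F x \<le> \<sigma>\<^sup>2) \<and>
          \<Delta> > 0 \<and> (\<forall>x. norm (gradient \<phi> x) \<le> \<Delta>))
       \<or>
       (\<exists>L0 L1 \<sigma> \<Delta> (N::nat) (f :: nat \<Rightarrow> real ^ 'n \<Rightarrow> real) (B :: 'e \<Rightarrow> nat set).
          L0L1_smooth L0 L1 F \<and>
          \<Delta> > 0 \<and> (\<forall>x. norm (gradient \<phi> x) \<le> \<Delta>) \<and>
          N \<ge> 1 \<and>
          (\<forall>i\<in>{1..N}. (\<forall>x. f i differentiable (at x)) \<and> bdd_below (range (f i))) \<and>
          (\<forall>x. F x = (1 / real N) * (\<Sum>i=1..N. f i x)) \<and>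
          B \<in> S \<rightarrow>\<^sub>M count_space (Pow {1..N} - {{}}) \<and>
          (\<forall>x. \<forall>e\<in>space S.
            g x e = (1 / real (card (B e))) *\<^sub>R (\<Sum>i\<in>B e. gradient (f i) x)) \<and>
          (\<forall>x. (\<integral>\<omega>. norm (g x (X \<omega>) - gradient F x) \<partial>M) \<le> \<sigma>) \<and>
          (\<forall>e\<in>space S.
            L0L1_smooth L0 L1 (\<lambda>x. (1 / real (card (B e))) * (\<Sum>i\<in>B e. f i x))))"
  shows "(AE \<omega> in M. bdd_above (range (\<lambda>k. norm (p k \<omega>))) \<and>
                     bdd_above (range (\<lambda>k. norm (q k \<omega>)))) \<and>
         (\<forall>k. integrable M (\<lambda>\<omega>. F (q k \<omega>))) \<and>
         bdd_above (range (\<lambda>k. (\<integral>\<omega>. F (q k \<omega>) \<partial>M)))"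
proof -
  interpret prob_space M by fact
  \<comment> \<open>No single squared step size exceeds the whole sum, so \<open>A\<close> bounds
    all step sizes and one constant serves every step.\<close>
  define A where "A = sqrt (\<Sum>k. (\<alpha> k)\<^sup>2)"
  have \<alpha>_bounds: "0 \<le> \<alpha> k" "\<alpha> k \<le> A" for k
  proof -
    show "0 \<le> \<alpha> k"
      using \<alpha>_0 \<alpha>_pos[of k] by (cases k) auto
    show "\<alpha> k \<le> A"
      unfolding A_def using sum_le_suminf[OF \<alpha>_sq_sum, of "{k}"] by (intro real_le_rsqrt) simp
  qed
  define noise where "noise = (\<lambda>x \<omega>. gradient F x - g x (X \<omega>))"
  define W where "W = (\<lambda>x. 1 + (F x - F_low))"
  have W: "1 \<le> W x" for x
    using F_bounded[of x] by (simp add: W_def)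
  have X_space: "X \<omega> \<in> space S" if "\<omega> \<in> space M" for \<omega>
    using generic that by (rule measurable_space)
  have grad_W: "norm (gradient F x) \<le> (4 * L1 + L0 / L1) * W x" if "L0L1_smooth L0 L1 F" for L0 L1 x
    unfolding W_def by (rule L0L1_smooth_gradient_le_energy[OF that F_bounded])
  \<comment> \<open>\<open>E\<close> collects the second-order effect of the noise; all that differs between the three
    settings is the choice of \<open>E\<close>, whose mean must be controlled by \<open>W\<close>.\<close>
  define dissipative where "dissipative = (\<lambda>E C C'. 0 \<le> C \<and> 0 \<le> C' \<and>
      (\<forall>x. integrable M (\<lambda>\<omega>. E x (X \<omega>)) \<and> (\<integral>\<omega>. E x (X \<omega>) \<partial>M) \<le> C' * W x) \<and>
      (\<forall>a p q e p'. 0 \<le> a \<longrightarrow> a \<le> A \<longrightarrow>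
        p' = p - a *\<^sub>R g q e - (a * \<gamma>) *\<^sub>R gradient \<phi> p \<longrightarrow>
        F (q + a *\<^sub>R gradient \<phi> p') + \<phi> p' \<le> F q + \<phi> p + a * (gradient \<phi> p \<bullet> (gradient F q - g q e))
          + a\<^sup>2 * (C * (W q + (\<phi> p - \<phi>_low) + E q e))))"
  have dissipativeI: "dissipative E C C'"
    if "0 \<le> C" "0 \<le> C'" "\<And>x. integrable M (\<lambda>\<omega>. E x (X \<omega>))" "\<And>x. (\<integral>\<omega>. E x (X \<omega>) \<partial>M) \<le> C' * W x"
      "\<And>a p q e p'. 0 \<le> a \<Longrightarrow> a \<le> A \<Longrightarrow>
        p' = p - a *\<^sub>R g q e - (a * \<gamma>) *\<^sub>R gradient \<phi> p \<Longrightarrow>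
        F (q + a *\<^sub>R gradient \<phi> p') + \<phi> p' \<le> F q + \<phi> p + a * (gradient \<phi> p \<bullet> (gradient F q - g q e))
          + a\<^sup>2 * (C * (W q + (\<phi> p - \<phi>_low) + E q e))" for E C C'
    unfolding dissipative_def by (intro conjI allI impI that)
  \<comment> \<open>The two settings with bounded gradient of \<phi> share the step estimate; they
    differ only in how the mean of the noise norm times \<open>1 + norm g\<close> is
    bounded.\<close>
  have ex_bounded: "\<exists>E C C'. dissipative E C C'"
    if smooth: "L0L1_smooth L0 L1 F" and \<phi>_grad: "\<And>x. norm (gradient \<phi> x) \<le> \<Delta>"
      and int: "\<And>x. integrable M (\<lambda>\<omega>. norm (noise x \<omega>) * (1 + norm (g x (X \<omega>))))"
      and bound: "\<And>x. (\<integral>\<omega>. norm (noise x \<omega>) * (1 + norm (g x (X \<omega>))) \<partial>M) \<le> C' * W x"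
      and C': "0 \<le> C'" for L0 L1 \<Delta> C'
  proof -
    obtain C where C: "0 \<le> C" and step: "\<And>a p q g p'. 0 \<le> a \<Longrightarrow> a \<le> A \<Longrightarrow>
        p' = p - a *\<^sub>R g - (a * \<gamma>) *\<^sub>R gradient \<phi> p \<Longrightarrow>
        F (q + a *\<^sub>R gradient \<phi> p') + \<phi> p' \<le> F q + \<phi> p + a * (gradient \<phi> p \<bullet> (gradient F q - g))
          + a\<^sup>2 * (C * (W q + norm (gradient F q - g) * (1 + norm g)))"
      unfolding W_def using energy_step_L0L1[OF \<phi>_convex \<phi>_smooth lam_pos \<phi>_grad smooth F_bounded
          less_imp_le[OF \<gamma>_pos], where A = A] by metis
    have "F (q + a *\<^sub>R gradient \<phi> p') + \<phi> p' \<le> F q + \<phi> p + a * (gradient \<phi> p \<bullet> (gradient F q - g q e))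
          + a\<^sup>2 * (C * (W q + (\<phi> p - \<phi>_low) + norm (gradient F q - g q e) * (1 + norm (g q e))))"
      if "0 \<le> a" "a \<le> A" "p' = p - a *\<^sub>R g q e - (a * \<gamma>) *\<^sub>R gradient \<phi> p" for a p q e p'
    proof -
      have "a\<^sup>2 * (C * (W q + norm (gradient F q - g q e) * (1 + norm (g q e))))
          \<le> a\<^sup>2 * (C * (W q + (\<phi> p - \<phi>_low) + norm (gradient F q - g q e) * (1 + norm (g q e))))"
        using C \<phi>_bounded[of p] by (intro mult_left_mono) auto
      with step[OF that, of q] show ?thesis
        by linarith
    qed
    from dissipativeI[of C C' "\<lambda>x e. norm (gradient F x - g x e) * (1 + norm (g x e))",
        OF C C' int[unfolded noise_def] bound[unfolded noise_def] this]
    show ?thesis by blast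
  qed

  \<comment> \<open>Noise estimates in the three settings\<close>
  have "\<exists>E C C'. dissipative E C C'"
    using settings
  proof (elim disjE)
    assume "\<exists>L \<kappa> \<tau> \<sigma>. L > 0 \<and> \<kappa> \<ge> 0 \<and> \<tau> \<ge> 0 \<and> \<sigma> \<ge> 0 \<and>
          (\<forall>x y. norm (gradient F y - gradient F x) \<le> L * norm (x - y)) \<and>
          (\<forall>x. finite_second_moment M X g x \<and>
            grad_variance M X g F x \<le> \<kappa> * (F x - F_low) + \<tau> * (norm (gradient F x))\<^sup>2 + \<sigma>\<^sup>2)"
    then obtain L \<kappa> \<tau> \<sigma> where L: "0 < L" and coeffs: "0 \<le> \<kappa>" "0 \<le> \<tau>"
      and lip: "\<And>x y. norm (gradient F y - gradient F x) \<le> L * norm (x - y)"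
      and moment: "\<And>x. finite_second_moment M X g x"
      and variance: "\<And>x. grad_variance M X g F x \<le> \<kappa> * (F x - F_low) + \<tau> * (norm (gradient F x))\<^sup>2 + \<sigma>\<^sup>2"
      by (elim exE conjE) (rule that; blast)
    note second_moment = centered_gradient_second_moment[OF moment g_integrable g_unbiased]
    \<comment> \<open>The squared gradient is at most \<open>4 * L\<close> times the excess of
      \<open>F\<close>, so all three terms of the variance bound become multiples of
      \<open>W x\<close>.\<close>
    have "(\<integral>\<omega>. (norm (gradient F x - g x (X \<omega>)))\<^sup>2 \<partial>M) \<le> (\<kappa> + 4 * \<tau> * L + \<sigma>\<^sup>2) * W x" for x
    proof -
      define u where "u = F x - F_low"
      define r where "r = 4 * \<tau> * L"
      have "\<tau> * (norm (gradient F x))\<^sup>2 \<le> \<tau> * (4 * L * u)"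
        unfolding u_def
        using coeffs by (intro mult_left_mono lipschitz_gradient_bound F_diff L lip F_bounded) auto
      then have "\<tau> * (norm (gradient F x))\<^sup>2 \<le> r * u"
        by (simp add: r_def)
      moreover have "0 \<le> \<sigma>\<^sup>2 * u" "0 \<le> r"
        using F_bounded[of x] coeffs L by (simp_all add: u_def r_def)
      ultimately show ?thesis
        using variance[of x] coeffs unfolding second_moment(2) W_def u_def[symmetric] r_def[symmetric]
        by (simp add: algebra_simps)
    qed
    moreover obtain C where "0 \<le> C" and "\<And>a p q g p'. 0 \<le> a \<Longrightarrow> a \<le> A \<Longrightarrow>
        p' = p - a *\<^sub>R g - (a * \<gamma>) *\<^sub>R gradient \<phi> p \<Longrightarrow>
        F (q + a *\<^sub>R gradient \<phi> p') + \<phi> p' \<le> F q + \<phi> p + a * (gradient \<phi> p \<bullet> (gradient F q - g))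
          + a\<^sup>2 * (C * (1 + (F q - F_low) + (\<phi> p - \<phi>_low) + (norm (gradient F q - g))\<^sup>2))"
      using energy_step_lipschitz[OF F_diff \<phi>_diff \<phi>_convex \<phi>_smooth lam_pos lip L F_bounded \<phi>_bounded
          less_imp_le[OF \<gamma>_pos], where A = A] by metis
    moreover have "0 \<le> \<kappa> + 4 * \<tau> * L + \<sigma>\<^sup>2"
      using coeffs L by simp
    ultimately have "dissipative (\<lambda>x e. (norm (gradient F x - g x e))\<^sup>2) C (\<kappa> + 4 * \<tau> * L + \<sigma>\<^sup>2)"
      using second_moment(1) unfolding W_def by (intro dissipativeI) (simp_all add: W_def)
    then show ?thesis by blast
  next
    assume "\<exists>L0 L1 \<sigma> \<Delta>. L0L1_smooth L0 L1 F \<and>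
          (\<forall>x. finite_second_moment M X g x \<and> grad_variance M X g F x \<le> \<sigma>\<^sup>2) \<and>
          \<Delta> > 0 \<and> (\<forall>x. norm (gradient \<phi> x) \<le> \<Delta>)"
    then obtain L0 L1 \<sigma> \<Delta> where smooth: "L0L1_smooth L0 L1 F"
      and moment: "\<And>x. finite_second_moment M X g x"
      and variance: "\<And>x. grad_variance M X g F x \<le> \<sigma>\<^sup>2"
      and \<phi>_grad: "\<And>x. norm (gradient \<phi> x) \<le> \<Delta>"
      by (elim exE conjE) (rule that; blast)
    have second_moment: "integrable M (\<lambda>\<omega>. (norm (noise x \<omega>))\<^sup>2)"
      "(\<integral>\<omega>. (norm (noise x \<omega>))\<^sup>2 \<partial>M) = grad_variance M X g F x" for x
      unfolding noise_def by (rule centered_gradient_second_moment[OF moment g_integrable g_unbiased])+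
    define d where "d = 4 * L1 + L0 / L1"
    have d: "0 \<le> d"
      using smooth by (simp add: d_def L0L1_smooth_def)
    show ?thesis
    proof (rule ex_bounded[OF smooth \<phi>_grad])
      fix x
      \<comment> \<open>Only second moments are controlled, so the first power of the noise is
        traded for 1 plus its square. The gradient norm then multiplies a quantity of bounded mean,
        and the result stays linear in \<open>W x\<close>.\<close>
      have dominate: "norm (noise x \<omega>) * (1 + norm (g x (X \<omega>)))
          \<le> (1 + norm (gradient F x)) * (1 + (norm (noise x \<omega>))\<^sup>2) + (norm (noise x \<omega>))\<^sup>2" for \<omega>
      proof -
        have "norm (g x (X \<omega>)) \<le> norm (gradient F x) + norm (noise x \<omega>)"
          using norm_triangle_ineq4[of "gradient F x" "noise x \<omega>"] by (simp add: noise_def)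
        then have "norm (noise x \<omega>) * (1 + norm (g x (X \<omega>)))
            \<le> norm (noise x \<omega>) * (1 + (norm (gradient F x) + norm (noise x \<omega>)))"
          by (intro mult_left_mono add_left_mono) auto
        also have "\<dots> = (1 + norm (gradient F x)) * norm (noise x \<omega>) + (norm (noise x \<omega>))\<^sup>2"
          by (simp add: algebra_simps power2_eq_square)
        also have "\<dots> \<le> (1 + norm (gradient F x)) * (1 + (norm (noise x \<omega>))\<^sup>2) + (norm (noise x \<omega>))\<^sup>2"
        proof -
          have "r \<le> 1 + r\<^sup>2" for r :: real
            using zero_le_power2[of "r - 1 / 2"] by (simp add: power2_eq_square algebra_simps)
          then show ?thesis
            by (intro add_right_mono mult_left_mono) auto
        qed
        finally show ?thesis .
      qed
      show int: "integrable M (\<lambda>\<omega>. norm (noise x \<omega>) * (1 + norm (g x (X \<omega>))))"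
      proof (rule Bochner_Integration.integrable_bound)
        show "integrable M (\<lambda>\<omega>. (1 + norm (gradient F x)) * (1 + (norm (noise x \<omega>))\<^sup>2) + (norm (noise x \<omega>))\<^sup>2)"
          using second_moment(1) by simp
        show "(\<lambda>\<omega>. norm (noise x \<omega>) * (1 + norm (g x (X \<omega>)))) \<in> borel_measurable M"
          unfolding noise_def using borel_measurable_integrable[OF g_integrable[of x]] by measurable
      qed (use dominate in \<open>auto intro!: AE_I2 simp: abs_mult\<close>)
      have "(\<integral>\<omega>. norm (noise x \<omega>) * (1 + norm (g x (X \<omega>))) \<partial>M)
          \<le> (\<integral>\<omega>. (1 + norm (gradient F x)) * (1 + (norm (noise x \<omega>))\<^sup>2) + (norm (noise x \<omega>))\<^sup>2 \<partial>M)"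
        using dominate second_moment(1) by (intro integral_mono int) auto
      also have "\<dots> = (1 + norm (gradient F x)) * (1 + grad_variance M X g F x) + grad_variance M X g F x"
        using second_moment by (simp add: prob_space)
      also have "\<dots> \<le> (1 + norm (gradient F x)) * (1 + \<sigma>\<^sup>2) + \<sigma>\<^sup>2"
        using variance[of x] by (intro add_mono mult_left_mono) auto
      also have "\<dots> \<le> (1 + d) * W x * (1 + \<sigma>\<^sup>2) + \<sigma>\<^sup>2 * W x"
        using W[of x] grad_W[OF smooth, of x] mult_left_mono[OF W[of x], of "\<sigma>\<^sup>2"]
        by (intro add_mono mult_right_mono) (auto simp: d_def algebra_simps)
      finally show "(\<integral>\<omega>. norm (noise x \<omega>) * (1 + norm (g x (X \<omega>))) \<partial>M)
          \<le> ((1 + d) * (1 + \<sigma>\<^sup>2) + \<sigma>\<^sup>2) * W x"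
        by (simp add: algebra_simps)
    qed (use d in simp)
  next
    assume "\<exists>L0 L1 \<sigma> \<Delta> (N::nat) (f :: nat \<Rightarrow> real ^ 'n \<Rightarrow> real) (B :: 'e \<Rightarrow> nat set).
          L0L1_smooth L0 L1 F \<and>
          \<Delta> > 0 \<and> (\<forall>x. norm (gradient \<phi> x) \<le> \<Delta>) \<and>
          N \<ge> 1 \<and>
          (\<forall>i\<in>{1..N}. (\<forall>x. f i differentiable (at x)) \<and> bdd_below (range (f i))) \<and>
          (\<forall>x. F x = (1 / real N) * (\<Sum>i=1..N. f i x)) \<and>
          B \<in> S \<rightarrow>\<^sub>M count_space (Pow {1..N} - {{}}) \<and>
          (\<forall>x. \<forall>e\<in>space S.
            g x e = (1 / real (card (B e))) *\<^sub>R (\<Sum>i\<in>B e. gradient (f i) x)) \<and>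
          (\<forall>x. (\<integral>\<omega>. norm (g x (X \<omega>) - gradient F x) \<partial>M) \<le> \<sigma>) \<and>
          (\<forall>e\<in>space S.
            L0L1_smooth L0 L1 (\<lambda>x. (1 / real (card (B e))) * (\<Sum>i\<in>B e. f i x)))"
    then obtain L0 L1 \<sigma> \<Delta> N and f :: "nat \<Rightarrow> real ^ 'n \<Rightarrow> real" and B :: "'e \<Rightarrow> nat set"
      where smooth: "L0L1_smooth L0 L1 F" and \<phi>_grad: "\<forall>x. norm (gradient \<phi> x) \<le> \<Delta>"
        and N: "1 \<le> N"
        and f: "\<forall>i\<in>{1..N}. (\<forall>x. f i differentiable (at x)) \<and> bdd_below (range (f i))"
        and F_mean: "\<forall>x. F x = (1 / real N) * (\<Sum>i=1..N. f i x)"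
        and B: "B \<in> S \<rightarrow>\<^sub>M count_space (Pow {1..N} - {{}})"
        and g_batch: "\<forall>x. \<forall>e\<in>space S.
          g x e = (1 / real (card (B e))) *\<^sub>R (\<Sum>i\<in>B e. gradient (f i) x)"
        and noise_bound: "\<forall>x. (\<integral>\<omega>. norm (g x (X \<omega>) - gradient F x) \<partial>M) \<le> \<sigma>"
        and batch_smooth: "\<forall>e\<in>space S.
          L0L1_smooth L0 L1 (\<lambda>x. (1 / real (card (B e))) * (\<Sum>i\<in>B e. f i x))"
      by (elim exE conjE) (rule that)
    note \<phi>_grad = \<phi>_grad[rule_format] and F_mean = F_mean[rule_format]
      and g_batch = g_batch[rule_format] and noise_bound = noise_bound[rule_format]
      and batch_smooth = batch_smooth[rule_format]
    have f_diff: "f i differentiable (at x)" and f_bdd: "bdd_below (range (f i))" if "i \<in> {1..N}" for i x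
      using bspec[OF f that] by auto
    obtain m where m: "\<And>i x. i \<in> {1..N} \<Longrightarrow> m i \<le> f i x"
      using f_bdd unfolding bdd_below_def by (metis rangeI)
    have pos: "0 \<le> L0" "0 < L1"
      using smooth by (auto simp: L0L1_smooth_def)
    \<comment> \<open>The factor \<open>real N\<close> comes from the sum of the \<open>f i\<close>
      being \<open>N\<close> times \<open>F\<close>; the absolute value absorbs the mismatch between
      \<open>real N * F_low\<close> and the sum of the individual lower bounds.\<close>
    define c where "c = 4 * L1 * (real N + \<bar>real N * F_low - (\<Sum>i=1..N. m i)\<bar>) + L0 / L1"
    have c: "0 \<le> c"
      using pos by (simp add: c_def)
    have g_le: "norm (g x e) \<le> c * W x" if e: "e \<in> space S" for x e
    proof -
      define u where "u = F x - F_low"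
      define r where "r = \<bar>real N * F_low - (\<Sum>i=1..N. m i)\<bar>"
      have u: "0 \<le> u"
        using F_bounded[of x] by (simp add: u_def)
      have Be: "B e \<subseteq> {1..N}" "B e \<noteq> {}"
        using measurable_space[OF B e] by auto
      have "(\<Sum>i=1..N. f i x - m i) = real N * F x - (\<Sum>i=1..N. m i)"
        using N by (simp add: F_mean sum_subtractf)
      also have "\<dots> \<le> real N * u + r"
        by (simp add: u_def r_def algebra_simps)
      also have "\<dots> \<le> (real N + r) * (1 + u)"
        using u by (simp add: r_def algebra_simps)
      finally have "4 * L1 * (\<Sum>i=1..N. f i x - m i) \<le> 4 * L1 * ((real N + r) * (1 + u))"
        using pos by (intro mult_left_mono) auto
      moreover have "norm (g x e) \<le> 4 * L1 * (\<Sum>i=1..N. f i x - m i) + L0 / L1"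
        unfolding g_batch[OF e]
        by (rule minibatch_gradient_bound[OF f_diff m finite_atLeastAtMost Be batch_smooth[OF e]])
      moreover have "L0 / L1 \<le> L0 / L1 * (1 + u)"
        using pos u mult_left_mono[of 1 "1 + u" "L0 / L1"] by simp
      ultimately have "norm (g x e) \<le> 4 * L1 * ((real N + r) * (1 + u)) + L0 / L1 * (1 + u)"
        by linarith
      also have "\<dots> = c * W x"
        unfolding c_def W_def r_def[symmetric] u_def[symmetric] by (simp add: distrib_right mult.assoc)
      finally show ?thesis .
    qed
    show ?thesis
    proof (rule ex_bounded[OF smooth \<phi>_grad])
      fix x
      have noise_int: "integrable M (noise x)"
        unfolding noise_def using g_integrable by simp
      \<comment> \<open>The stochastic gradient is bounded by the energy for every noise value, so
        the noise enters only to the first power and its mean absolute bound suffices.\<close>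
      have dominate: "norm (noise x \<omega>) * (1 + norm (g x (X \<omega>))) \<le> (1 + c * W x) * norm (noise x \<omega>)"
        if "\<omega> \<in> space M" for \<omega>
        using g_le[OF X_space[OF that], of x] by (simp add: mult.commute mult_left_mono)
      show int: "integrable M (\<lambda>\<omega>. norm (noise x \<omega>) * (1 + norm (g x (X \<omega>))))"
      proof (rule Bochner_Integration.integrable_bound)
        show "integrable M (\<lambda>\<omega>. (1 + c * W x) * norm (noise x \<omega>))"
          using noise_int by simp
        show "(\<lambda>\<omega>. norm (noise x \<omega>) * (1 + norm (g x (X \<omega>)))) \<in> borel_measurable M"
          unfolding noise_def using borel_measurable_integrable[OF g_integrable[of x]] by measurable
        show "AE \<omega> in M. norm (norm (noise x \<omega>) * (1 + norm (g x (X \<omega>)))) \<le> norm ((1 + c * W x) * norm (noise x \<omega>))"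
          using dominate c W[of x] by (auto intro!: AE_I2 simp: abs_mult)
      qed
      have "(\<integral>\<omega>. norm (noise x \<omega>) * (1 + norm (g x (X \<omega>))) \<partial>M)
          \<le> (\<integral>\<omega>. (1 + c * W x) * norm (noise x \<omega>) \<partial>M)"
        using dominate noise_int by (intro integral_mono int) auto
      also have "\<dots> = (1 + c * W x) * (\<integral>\<omega>. norm (g x (X \<omega>) - gradient F x) \<partial>M)"
        by (simp add: noise_def norm_minus_commute)
      also have "\<dots> \<le> ((1 + c) * W x) * \<bar>\<sigma>\<bar>"
        using noise_bound[of x] W[of x] c by (intro mult_mono) (auto simp: algebra_simps)
      finally show "(\<integral>\<omega>. norm (noise x \<omega>) * (1 + norm (g x (X \<omega>))) \<partial>M) \<le> ((1 + c) * \<bar>\<sigma>\<bar>) * W x"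
        by (simp add: algebra_simps)
    qed (use c in simp)
  qed
  then obtain E C C' where diss: "dissipative E C C'"
    by blast
  have C: "0 \<le> C" "0 \<le> C'"
    and E: "\<And>x. integrable M (\<lambda>\<omega>. E x (X \<omega>))" "\<And>x. (\<integral>\<omega>. E x (X \<omega>) \<partial>M) \<le> C' * W x"
    using diss by (simp_all add: dissipative_def)
  have step: "F (q + a *\<^sub>R gradient \<phi> p') + \<phi> p' \<le> F q + \<phi> p + a * (gradient \<phi> p \<bullet> (gradient F q - g q e))
        + a\<^sup>2 * (C * (W q + (\<phi> p - \<phi>_low) + E q e))"
    if "0 \<le> a" "a \<le> A" "p' = p - a *\<^sub>R g q e - (a * \<gamma>) *\<^sub>R gradient \<phi> p" for a p q e p'
    using diss that by (simp add: dissipative_def)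

  \<comment> \<open>The scheme as a noise recursion with energy \<open>V\<close>\<close>
  define V where "V = (\<lambda>(p, q). W q + (\<phi> p - \<phi>_low))"
  have V: "W (snd y) \<le> V y" "1 \<le> V y" for y
    using W[of "snd y"] \<phi>_bounded[of "fst y"] by (auto simp: V_def case_prod_beta)
  \<comment> \<open>The position update uses the momentum already updated in the same step.\<close>
  define T where "T = (\<lambda>k ((p, q), e).
    let p' = p - \<alpha> k *\<^sub>R g q e - (\<alpha> k * \<gamma>) *\<^sub>R gradient \<phi> p in (p', q + \<alpha> k *\<^sub>R gradient \<phi> p'))"
  define Y where "Y = (\<lambda>k \<omega>. (p k \<omega>, q k \<omega>))"
  define b where "b = (\<lambda>k. C * (1 + C') * (\<alpha> k)\<^sup>2)"
  let ?N = "borel \<Otimes>\<^sub>M borel :: ((real ^ 'n) \<times> (real ^ 'n)) measure"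
  have F_meas[measurable]: "F \<in> borel_measurable borel" and [measurable]: "\<phi> \<in> borel_measurable borel"
    using F_diff \<phi>_diff
    by (auto intro!: borel_measurable_continuous_onI differentiable_imp_continuous_on
        simp: differentiable_on_def intro: differentiable_at_withinI)
  have [measurable]: "gradient \<phi> \<in> borel_measurable borel"
  proof -
    have "lam-lipschitz_on UNIV (gradient \<phi>)"
      using \<phi>_smooth lam_pos by (intro lipschitz_onI) (auto simp: dist_norm norm_minus_commute)
    then show ?thesis
      by (intro borel_measurable_continuous_onI lipschitz_on_continuous_on)
  qed
  have [measurable]: "(\<lambda>z. g (f z) (h z)) \<in> borel_measurable R"
    if "f \<in> R \<rightarrow>\<^sub>M borel" "h \<in> R \<rightarrow>\<^sub>M S" for f h and R :: "'r measure"
    using measurable_compose[OF measurable_Pair[OF that] g_meas] by simp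
  have T_meas: "T k \<in> ?N \<Otimes>\<^sub>M S \<rightarrow>\<^sub>M ?N" for k
    unfolding T_def Let_def case_prod_beta by measurable
  have V_meas[measurable]: "(\<lambda>y. ennreal (V y)) \<in> borel_measurable ?N"
    unfolding V_def W_def case_prod_beta by measurable
  have growth: "(\<integral>\<^sup>+\<omega>. ennreal (V (T k (y, X \<omega>))) \<partial>M) \<le> ennreal (1 + b k) * ennreal (V y)"
    if "y \<in> space ?N" for k y
  proof (cases y)
    case (Pair p q)
    have "V (T k (y, e)) \<le> V y + \<alpha> k * (gradient \<phi> p \<bullet> (gradient F q - g q e))
        + (\<alpha> k)\<^sup>2 * (C * (V y + E q e))" for e
      using step[OF \<alpha>_bounds refl, of q k p e] by (simp add: Pair V_def T_def W_def Let_def)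
    moreover have "(\<integral>\<omega>. E q (X \<omega>) \<partial>M) \<le> C' * V y"
      using E(2)[of q] mult_left_mono[OF V(1)[of y] C(2)] by (simp add: Pair)
    moreover have "0 \<le> V y" for y
      using V(2)[of y] by simp
    ultimately show ?thesis
      unfolding b_def using C
      by (intro nn_integral_energy_growth[OF g_integrable[of q] g_unbiased E(1)[of q]])
  qed
  have b: "0 \<le> b k" "summable b" for k
    unfolding b_def using C \<alpha>_sq_sum by (auto intro: summable_mult)
  have Y_0: "Y 0 \<omega> = (0, q0)" if "\<omega> \<in> space M" for \<omega>
    using that by (simp add: Y_def p_init q_init)
  have Y_Suc: "Y (Suc k) \<omega> = T k (Y k \<omega>, \<xi> k \<omega>)" if "\<omega> \<in> space M" for k \<omega>
    using that by (simp add: Y_def T_def Let_def p_step q_step)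
  have y0: "(0, q0) \<in> space ?N"
    by (simp add: space_pair_measure)
  note recursion = indep generic same_distr Y_0 y0 Y_Suc T_meas
  have Y_meas[measurable]: "Y k \<in> M \<rightarrow>\<^sub>M ?N" for k
    by (rule noise_recursion_measurable[OF recursion])

  \<comment> \<open>Bounded paths and bounded expectations\<close>
  have "AE \<omega> in M. \<exists>c::nat. \<forall>k. ennreal (V (Y k \<omega>)) \<le> of_nat c"
    by (rule noise_recursion_AE_bounded[OF recursion V_meas growth b]) simp_all
  then have "AE \<omega> in M. bdd_above (range (\<lambda>k. norm (p k \<omega>))) \<and> bdd_above (range (\<lambda>k. norm (q k \<omega>)))"
  proof eventually_elim
    case (elim \<omega>)
    then obtain c :: nat where c: "\<And>k. V (p k \<omega>, q k \<omega>) \<le> real c"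
      by (auto simp: Y_def ennreal_of_nat_eq_real_of_nat)
    \<comment> \<open>Both summands of \<open>V\<close> are nonnegative, so a bound on
      \<open>V\<close> places each iterate in a sublevel set of \<phi> or \<open>F\<close>, which
      coercivity makes bounded.\<close>
    obtain bp where bp: "\<And>x. \<phi> x \<le> real c + \<phi>_low \<Longrightarrow> norm x \<le> bp"
      using coercive_sublevel_bounded[OF \<phi>_coercive, of "real c + \<phi>_low"] by metis
    obtain bq where bq: "\<And>x. F x \<le> real c + F_low \<Longrightarrow> norm x \<le> bq"
      using coercive_sublevel_bounded[OF F_coercive, of "real c + F_low"] by metis
    have "norm (p k \<omega>) \<le> bp" "norm (q k \<omega>) \<le> bq" for k
      using c[of k] W[of "q k \<omega>"] \<phi>_bounded[of "p k \<omega>"]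
      by (auto intro!: bp bq simp: V_def W_def)
    then show ?case
      by (auto simp: bdd_above_def)
  qed
  moreover define K where "K = exp (suminf b) * V (0, q0)"
  have V_int: "integrable M (\<lambda>\<omega>. V (Y k \<omega>))" and V_bound: "(\<integral>\<omega>. V (Y k \<omega>) \<partial>M) \<le> K" for k
  proof -
    have nonneg: "0 \<le> V (Y k \<omega>)" for \<omega>
      using V(2)[of "Y k \<omega>"] by simp
    have meas: "(\<lambda>\<omega>. V (Y k \<omega>)) \<in> borel_measurable M"
      using measurable_compose[OF Y_meas[of k], of V borel]
      unfolding V_def W_def case_prod_beta by measurable
    have "(\<integral>\<^sup>+\<omega>. ennreal (V (Y k \<omega>)) \<partial>M) \<le> ennreal (exp (suminf b)) * ennreal (V (0, q0))"
      by (rule noise_recursion_expectation_bound[OF recursion V_meas growth b])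
    also have "\<dots> = ennreal K"
      unfolding K_def by (rule ennreal_mult'[symmetric]) simp
    finally have nn: "(\<integral>\<^sup>+\<omega>. ennreal (V (Y k \<omega>)) \<partial>M) \<le> ennreal K" .
    then show int: "integrable M (\<lambda>\<omega>. V (Y k \<omega>))"
      using meas nonneg by (intro integrableI_nonneg) (auto intro: le_less_trans)
    have "0 \<le> K"
      using V(2)[of "(0, q0)"] by (simp add: K_def)
    then show "(\<integral>\<omega>. V (Y k \<omega>) \<partial>M) \<le> K"
      using nn nonneg by (subst (asm) nn_integral_eq_integral[OF int]) auto
  qed
  \<comment> \<open>The first bound controls the expectation; the two-sided one, using
    \<open>F_low\<close> from below, gives integrability by domination.\<close>
  have F_V: "F (q k \<omega>) \<le> V (Y k \<omega>) + \<bar>F_low\<bar>" "\<bar>F (q k \<omega>)\<bar> \<le> V (Y k \<omega>) + \<bar>F_low\<bar>" for k \<omega>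
    using V(1)[of "Y k \<omega>"] F_bounded[of "q k \<omega>"] by (auto simp: Y_def W_def)
  have F_int: "integrable M (\<lambda>\<omega>. F (q k \<omega>))" for k
  proof (rule Bochner_Integration.integrable_bound)
    show "integrable M (\<lambda>\<omega>. V (Y k \<omega>) + \<bar>F_low\<bar>)"
      using V_int by simp
    have "(\<lambda>\<omega>. F (snd (Y k \<omega>))) \<in> borel_measurable M"
      by measurable
    then show "(\<lambda>\<omega>. F (q k \<omega>)) \<in> borel_measurable M"
      by (simp add: Y_def)
    show "AE \<omega> in M. norm (F (q k \<omega>)) \<le> norm (V (Y k \<omega>) + \<bar>F_low\<bar>)"
      using F_V(2) by (auto intro!: AE_I2 intro: order_trans[OF _ abs_ge_self])
  qed
  moreover have "(\<integral>\<omega>. F (q k \<omega>) \<partial>M) \<le> K + \<bar>F_low\<bar>" for k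
  proof -
    have "(\<integral>\<omega>. F (q k \<omega>) \<partial>M) \<le> (\<integral>\<omega>. V (Y k \<omega>) + \<bar>F_low\<bar> \<partial>M)"
      using V_int F_V(1) by (intro integral_mono F_int) auto
    also have "\<dots> \<le> K + \<bar>F_low\<bar>"
      using V_int V_bound by (simp add: prob_space)
    finally show ?thesis .
  qed
  ultimately show ?thesis
    by (auto simp: bdd_above_def)
qed

end
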